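(* Let $m\geqslant 1$ and $n\geqslant 1$ be integers. Let ${}^{(m)}\mathrm{Sh}_{1,n-1}\in\mathbb{Z}G(m,1,n)$ be the 1-shuffle element $${}^{(m)}\mathrm{Sh}_{1,n-1}=\left(1+s_{n-1}+s_{n-2}s_{n-1}+\dots+s_1s_2\cdots s_{n-1}\right)\left(1+t_n+t_n^2+\dots+t_n^{m-1}\right),$$ and let $L:\mathbb{Z}G(m,1,n)\to\mathbb{Z}G(m,1,n)$, $y\mapsto {}^{(m)}\mathrm{Sh}_{1,n-1}\,y$, be the operator of left multiplication by it. Then $L$ is diagonalizable (over $\mathbb{Q}$, i.e. after extension of scalars to $\mathbb{Q}G(m,1,n)$) with eigenvalues $im$, $i=0,1,\dots,n-1,n$. For each $i\in\{0,1,\dots,n\}$ the multiplicity of the eigenvalue $im$ equals $\binom{n}{i}d_{m,n-i}$, which is the number of elements of $G(m,1,n)$ with exactly $i$ fixed points (a multiplicity equal to $0$ means that $im$ is not an eigenvalue).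
   Context: Let $C_m$ be the cyclic group of order $m$ with generator $\gamma$, and let $E=\{(x,\rho): x\in\{1,\dots,n\},\ \rho\in C_m\}$, with $C_m$ acting on $E$ by $\rho\cdot(x,\rho')=(x,\rho\rho')$. The complex reflection group $G(m,1,n)$ is identified with the group of all permutations $\pi$ of the set $E$ such that $\pi(x,\rho)=\rho\cdot\pi(x,1)$ for all $x\in\{1,\dots,n\}$, $\rho\in C_m$. (Equivalently, it is the group of $n\times n$ complex matrices with exactly one nonzero entry in each row and column, the nonzero entries being $m$-th roots of unity.) It has order $m^n n!$; $G(m,1,0)$ is the trivial group. The elements $s_1,\dots,s_{n-1},t$ of $G(m,1,n)$ are given by $s_i(x,1)=(\pi_i(x),1)$, where $\pi_i$ is the transposition $(i,i+1)$, and $t(1,1)=(1,\gamma)$, $t(x,1)=(x,1)$ for $x\neq1$. One sets $t_1=t$ and $t_{i+1}=s_it_is_i$ for $i=1,\dots,n-1$; thus $t_i$ sends $(i,\rho)$ to $(i,\gamma\rho)$ and fixes $(x,\rho)$ for $x\ne i$. An element $g\in G(m,1,n)$ has $i$ fixed points if there are exactly $i$ values $x\in\{1,\dots,n\}$ with $g(x,1)=(x,1)$ (in matrix terms, exactly $i$ diagonal entries equal to $1$). The $m$-derangement number $d_{m,n}$ is the number of elements of $G(m,1,n)$ with no fixed points; $d_{m,0}=1$. $\mathbb{Z}G(m,1,n)$ denotes the integral group ring and $\mathbb{Q}G(m,1,n)$ the rational group algebra. *)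

theory Defs
  imports
    Complex_Main
    "HOL-Algebra.Elementary_Groups"
    "HOL-Algebra.Generated_Groups"
    "HOL-Combinatorics.Permutations"
    "HOL-Library.Function_Algebras"
begin

section \<open>The complex reflection group \<open>G(m,1,n)\<close>\<close>

text \<open>For \<open>m \<ge> 1\<close>, \<^const>\<open>integer_mod_group\<close> has carrier \<open>{0..<m}\<close> and addition modulo \<open>m\<close>;
  it is used through the (multiplicative) notation of HOL-Algebra.\<close>

abbreviation cyc :: "nat \<Rightarrow> int monoid"
  where "cyc m \<equiv> integer_mod_group m"

definition pts :: "nat \<Rightarrow> nat \<Rightarrow> (nat \<times> int) set"
  where "pts m n = {1..n} \<times> carrier (cyc m)"

definition act :: "nat \<Rightarrow> int \<Rightarrow> nat \<times> int \<Rightarrow> nat \<times> int"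
  where "act m \<rho> p = (fst p, \<rho> \<otimes>\<^bsub>cyc m\<^esub> snd p)"

text \<open>Permutations of \<open>pts m n\<close> are represented, as in \<^const>\<open>permutes\<close>, by functions that
  are the identity outside \<open>pts m n\<close>.\<close>

definition refl_group :: "nat \<Rightarrow> nat \<Rightarrow> (nat \<times> int \<Rightarrow> nat \<times> int) monoid"
  where "refl_group m n =
    \<lparr>carrier = {\<pi>. \<pi> permutes pts m n \<and>
        (\<forall>x\<in>{1..n}. \<forall>\<rho>\<in>carrier (cyc m). \<pi> (x, \<rho>) = act m \<rho> (\<pi> (x, \<one>\<^bsub>cyc m\<^esub>)))},
     monoid.mult = (\<circ>), one = id\<rparr>"

text \<open>The equivariant map determined by the images \<open>f x\<close> of the points \<open>(x, 1)\<close>.\<close>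

definition equivariant_map ::
    "nat \<Rightarrow> nat \<Rightarrow> (nat \<Rightarrow> nat \<times> int) \<Rightarrow> nat \<times> int \<Rightarrow> nat \<times> int"
  where "equivariant_map m n f p = (if p \<in> pts m n then act m (snd p) (f (fst p)) else p)"

definition s_elt :: "nat \<Rightarrow> nat \<Rightarrow> nat \<Rightarrow> nat \<times> int \<Rightarrow> nat \<times> int"
  where "s_elt m n i = equivariant_map m n (\<lambda>x. (transpose i (i + 1) x, \<one>\<^bsub>cyc m\<^esub>))"

definition t_elt :: "nat \<Rightarrow> nat \<Rightarrow> int \<Rightarrow> nat \<times> int \<Rightarrow> nat \<times> int"
  where "t_elt m n \<gamma> = equivariant_map m n (\<lambda>x. (x, if x = 1 then \<gamma> else \<one>\<^bsub>cyc m\<^esub>))"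

text \<open>\<open>t\<^sub>1 = t\<close> and \<open>t\<^sub>i\<^sub>+\<^sub>1 = s\<^sub>i t\<^sub>i s\<^sub>i\<close>; the value at index \<open>0\<close> is a dummy.\<close>

primrec ti_elt :: "nat \<Rightarrow> nat \<Rightarrow> int \<Rightarrow> nat \<Rightarrow> nat \<times> int \<Rightarrow> nat \<times> int"
  where
    "ti_elt m n \<gamma> 0 = \<one>\<^bsub>refl_group m n\<^esub>"
  | "ti_elt m n \<gamma> (Suc i) =
      (if i = 0 then t_elt m n \<gamma>
       else s_elt m n i \<otimes>\<^bsub>refl_group m n\<^esub> ti_elt m n \<gamma> i \<otimes>\<^bsub>refl_group m n\<^esub> s_elt m n i)"

definition fixed_points :: "nat \<Rightarrow> nat \<Rightarrow> (nat \<times> int \<Rightarrow> nat \<times> int) \<Rightarrow> nat set"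
  where "fixed_points m n g = {x \<in> {1..n}. g (x, \<one>\<^bsub>cyc m\<^esub>) = (x, \<one>\<^bsub>cyc m\<^esub>)}"

definition derangement_number :: "nat \<Rightarrow> nat \<Rightarrow> nat"
  where "derangement_number m n =
    card {g \<in> carrier (refl_group m n). fixed_points m n g = {}}"


section \<open>Group rings of finite groups\<close>

text \<open>Elements of \<open>RG\<close>, for a finite group \<open>G\<close>, are coefficient functions supported on the carrier
  of \<open>G\<close>; addition is pointwise. The product \<^const>\<open>times\<close> of functions is pointwise and
  is not the product of \<open>RG\<close>, which is \<open>gr_mult\<close> below.\<close>

definition group_ring :: "('g, 'x) monoid_scheme \<Rightarrow> ('g \<Rightarrow> 'r::comm_ring_1) set"
  where "group_ring G = {a. \<forall>g. g \<notin> carrier G \<longrightarrow> a g = 0}"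

definition gr_of :: "'g \<Rightarrow> 'g \<Rightarrow> 'r::comm_ring_1"
  where "gr_of g = (\<lambda>h. if h = g then 1 else 0)"

definition gr_mult ::
    "('g, 'x) monoid_scheme \<Rightarrow> ('g \<Rightarrow> 'r::comm_ring_1) \<Rightarrow> ('g \<Rightarrow> 'r) \<Rightarrow> 'g \<Rightarrow> 'r"
  where "gr_mult G a b =
    (\<lambda>x. \<Sum>g\<in>carrier G. \<Sum>h\<in>carrier G. if g \<otimes>\<^bsub>G\<^esub> h = x then a g * b h else 0)"

text \<open>The \<open>\<rat>\<close>-linear extension to \<open>\<rat>G\<close> of an additive map \<open>\<int>G \<rightarrow> \<int>G\<close>.\<close>

definition rat_extension ::
    "('g, 'x) monoid_scheme \<Rightarrow> (('g \<Rightarrow> int) \<Rightarrow> 'g \<Rightarrow> int) \<Rightarrow> ('g \<Rightarrow> rat) \<Rightarrow> 'g \<Rightarrow> rat"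
  where "rat_extension G T y = (\<lambda>x. \<Sum>g\<in>carrier G. y g * of_int (T (gr_of g) x))"


section \<open>The 1-shuffle element\<close>

definition s_word :: "nat \<Rightarrow> nat \<Rightarrow> nat \<Rightarrow> nat \<times> int \<Rightarrow> nat \<times> int"
  where "s_word m n k =
    foldr (\<lambda>i w. s_elt m n i \<otimes>\<^bsub>refl_group m n\<^esub> w) [k..<n] \<one>\<^bsub>refl_group m n\<^esub>"

text \<open>\<open>s_word m n k\<close> is \<open>s\<^sub>k s\<^sub>k\<^sub>+\<^sub>1 \<dots> s\<^sub>n\<^sub>-\<^sub>1\<close>; for \<open>k = n\<close> it is the identity.\<close>

definition shuffle :: "nat \<Rightarrow> nat \<Rightarrow> int \<Rightarrow> (nat \<times> int \<Rightarrow> nat \<times> int) \<Rightarrow> int"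
  where "shuffle m n \<gamma> =
    gr_mult (refl_group m n)
      (\<Sum>k\<in>{1..n}. gr_of (s_word m n k))
      (\<Sum>j<m. gr_of (ti_elt m n \<gamma> n [^]\<^bsub>refl_group m n\<^esub> j))"

definition shuffle_op ::
    "nat \<Rightarrow> nat \<Rightarrow> int \<Rightarrow> ((nat \<times> int \<Rightarrow> nat \<times> int) \<Rightarrow> int) \<Rightarrow> (nat \<times> int \<Rightarrow> nat \<times> int) \<Rightarrow> int"
  where "shuffle_op m n \<gamma> y = gr_mult (refl_group m n) (shuffle m n \<gamma>) y"


section \<open>Diagonalizability, eigenvalues and multiplicities\<close>

text \<open>In the next definitions \<open>T\<close> is meant to be a linear operator on the subspace \<open>V\<close>.\<close>

definition (in vector_space) diagonalizable_on :: "'b set \<Rightarrow> ('b \<Rightarrow> 'b) \<Rightarrow> bool"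
  where "diagonalizable_on V T \<longleftrightarrow>
    (\<exists>B. independent B \<and> span B = V \<and> (\<forall>b\<in>B. \<exists>c. T b = scale c b))"

definition (in vector_space) eigenvalue_on :: "'b set \<Rightarrow> ('b \<Rightarrow> 'b) \<Rightarrow> 'a \<Rightarrow> bool"
  where "eigenvalue_on V T c \<longleftrightarrow> (\<exists>v\<in>V. v \<noteq> 0 \<and> T v = scale c v)"

definition (in vector_space) multiplicity_on :: "'b set \<Rightarrow> ('b \<Rightarrow> 'b) \<Rightarrow> 'a \<Rightarrow> nat"
  where "multiplicity_on V T c = dim {v \<in> V. T v = scale c v}"

definition fun_scale :: "'k::field \<Rightarrow> ('g \<Rightarrow> 'k) \<Rightarrow> 'g \<Rightarrow> 'k"
  where "fun_scale c f = (\<lambda>x. c * f x)"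

global_interpretation fun_space: vector_space fun_scale
  by unfold_locales (auto simp: fun_scale_def fun_eq_iff algebra_simps)

end

theory Submission
  imports Defs
begin

text \<open>No eigenvector is written down: every multiplicity comes from traces. Left
  multiplication by R_b sends g to R_b g, and the coefficient of g in R_b g is the coefficient of 1
  in R_b, which is 1; summing over g gives the group order, the same for every b. On an eigenvector
  with eigenvalue i m, the falling product with a factors is the scalar m^a a! (i choose a). Hence
  the a-th binomial moment of the eigenvalue indices is m^n n! / (m^a a!) = (n choose a) m^(n-a)
  (n-a)!. This number also counts the pairs of a group element and an a-element set of its fixed
  points, since the elements that fix a given a-set form a copy of G(m,1,n-a). The n + 1 moments a =
  0, ..., n suffice because the matrix of binomial coefficients is unitriangular.\<close>

text \<open>For \<open>b \<le> n\<close> let \<open>R\<^sub>b\<close> be the sum in the group ring of the elements that fix the colours and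
  preserve the order of the points \<open>1, \<dots>, b\<close>; then \<open>R\<^sub>n = 1\<close> and \<open>R\<^sub>0\<close> is the sum of all elements.
  Tracking the position of the last point gives
  \<open>Sh R\<^sub>b = m (n - b) R\<^sub>b + R\<^sub>b\<^sub>-\<^sub>1\<close>, with \<open>R\<^sub>-\<^sub>1 = 0\<close>. Hence \<open>R\<^sub>n\<^sub>-\<^sub>a\<close> is the falling product
  of the \<open>Sh - k m\<close> for \<open>k < a\<close>, and the product over all \<open>k \<le> n\<close> vanishes, so that left
  multiplication by \<open>Sh\<close> is diagonalizable. The trace of left multiplication by each \<open>R\<^sub>b\<close> is the
  group order; evaluated in an eigenbasis, this says that the binomial moments of the eigenvalue
  indices agree with those of the numbers of fixed points, hence so do the distributions.\<close>


section \<open>Diagonalization by an annihilating product\<close>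

text \<open>The operator (T - c (a-1)) ... (T - c 0). The newest factor stands outermost, so that
  each further factor is one application of the recursion for Sh. Scalar multiplication is a
  parameter, so that one constant serves both the abstract locale and
  \<open>fun_scale\<close>.\<close>

primrec falling_op ::
    "('k \<Rightarrow> 'b \<Rightarrow> 'b::ab_group_add) \<Rightarrow> ('b \<Rightarrow> 'b) \<Rightarrow> (nat \<Rightarrow> 'k) \<Rightarrow> nat \<Rightarrow> 'b \<Rightarrow> 'b"
  where
    "falling_op s T c 0 v = v"
  | "falling_op s T c (Suc a) v = T (falling_op s T c a v) - s (c a) (falling_op s T c a v)"

context vector_space
begin

lemma module_hom_falling_op:
  assumes "module_hom scale scale T"
  shows "module_hom scale scale (falling_op scale T c a)"
proof -
  interpret T: module_hom scale scale T by fact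
  have add: "falling_op scale T c a (x + y) = falling_op scale T c a x + falling_op scale T c a y" for x y
    by (induction a) (auto simp: T.add algebra_simps)
  have sc: "falling_op scale T c a (scale r x) = scale r (falling_op scale T c a x)" for r x
    by (induction a) (auto simp: T.scale algebra_simps)
  show ?thesis
    using add sc by (simp add: module_hom_iff module_axioms)
qed

lemma falling_op_eigenvector:
  assumes "module_hom scale scale T" and "T v = scale e v"
  shows "falling_op scale T c a v = scale (\<Prod>k<a. e - c k) v"
proof -
  interpret T: module_hom scale scale T by fact
  show ?thesis
    by (induction a) (auto simp: T.scale assms(2) algebra_simps)
qed

lemma falling_op_closed:
  assumes "subspace V" and "T ` V \<subseteq> V" and "v \<in> V"
  shows "falling_op scale T c a v \<in> V"
proof (induction a)
  case (Suc a)
  then show ?case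
    using assms by (auto intro!: subspace_diff subspace_scale)
qed (simp add: assms)

text \<open>Peel off the last factor: w, the product of the first a factors applied to v, is killed
  by T - c a, so it is zero or an eigenvector for c a. On w those a factors act as the scalar
  \<open>\<alpha>\<close>, nonzero because the c k are distinct. Hence v - w /
  \<open>\<alpha>\<close> is killed by the shorter product.\<close>

lemma in_span_eigenvectors:
  assumes T: "module_hom scale scale T" and V: "subspace V" "T ` V \<subseteq> V"
    and "inj_on c {..<a}" and "v \<in> V" and "falling_op scale T c a v = 0"
  shows "v \<in> span {u \<in> V. \<exists>k<a. T u = scale (c k) u}"
  using assms(4-)
proof (induction a arbitrary: v)
  case 0
  then show ?case by (simp add: span_zero)
next
  case (Suc a)
  interpret F: module_hom scale scale "falling_op scale T c a"
    by (rule module_hom_falling_op[OF T])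
  define w where "w = falling_op scale T c a v"
  define \<alpha> where "\<alpha> = (\<Prod>k<a. c a - c k)"
  have Tw: "T w = scale (c a) w"
    using Suc.prems(3) by (simp add: w_def)
  have wV: "w \<in> V"
    unfolding w_def by (rule falling_op_closed[OF V Suc.prems(2)])
  have "\<alpha> \<noteq> 0"
    using Suc.prems(1) by (force simp: \<alpha>_def inj_on_def)
  then have "falling_op scale T c a (v - scale (inverse \<alpha>) w) = 0"
    using falling_op_eigenvector[OF T Tw, of c a]
    by (simp add: F.diff F.scale flip: w_def \<alpha>_def)
  moreover have "v - scale (inverse \<alpha>) w \<in> V"
    using V(1) Suc.prems(2) wV by (auto intro!: subspace_diff subspace_scale)
  moreover have "inj_on c {..<a}"
    using Suc.prems(1) by (rule inj_on_subset) auto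
  ultimately have "v - scale (inverse \<alpha>) w \<in> span {u \<in> V. \<exists>k<a. T u = scale (c k) u}"
    by (intro Suc.IH)
  then have 1: "v - scale (inverse \<alpha>) w \<in> span {u \<in> V. \<exists>k<Suc a. T u = scale (c k) u}"
    by (rule subsetD[OF span_mono, rotated]) (auto simp: less_Suc_eq)
  have "w \<in> span {u \<in> V. \<exists>k<Suc a. T u = scale (c k) u}"
    using wV Tw by (auto intro!: span_base)
  from span_add[OF 1 span_scale[OF this, of "inverse \<alpha>"]] show ?case by simp
qed

text \<open>The eigenvectors span V, so a maximal independent set of them is a basis of V.\<close>

lemma eigenbasis_exists:
  assumes T: "module_hom scale scale T" and V: "subspace V" "T ` V \<subseteq> V"
    and "inj_on c {..<a}" and "\<And>v. v \<in> V \<Longrightarrow> falling_op scale T c a v = 0"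
  obtains B where "independent B" "span B = V" "\<forall>b\<in>B. \<exists>k<a. T b = scale (c k) b"
proof -
  let ?E = "{u \<in> V. \<exists>k<a. T u = scale (c k) u}"
  obtain B where B: "B \<subseteq> ?E" "independent B" "?E \<subseteq> span B"
    using maximal_independent_subset by blast
  have "V \<subseteq> span ?E"
    using in_span_eigenvectors[OF T V assms(4)] assms(5) by blast
  also have "\<dots> \<subseteq> span B"
    using B(3) by (simp add: span_minimal)
  finally have "span B = V"
    using B(1) V(1) by (intro span_subspace) auto
  with B show thesis by (intro that) auto
qed

text \<open>Comparing coordinates in the eigenbasis, T v = r v forces each coordinate of v times e b
  - r to vanish, so only basis vectors with e b = r occur in v.\<close>

lemma eigenspace_subset_span:
  assumes T: "module_hom scale scale T" and B: "independent B" "finite B"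
    and e: "\<And>b. b \<in> B \<Longrightarrow> T b = scale (e b) b"
    and v: "v \<in> span B" "T v = scale r v"
  shows "v \<in> span {b \<in> B. e b = r}"
proof -
  interpret T: module_hom scale scale T by fact
  define \<phi> where "\<phi> = representation B v"
  have v_eq: "v = (\<Sum>b\<in>B. scale (\<phi> b) b)"
    unfolding \<phi>_def using sum_representation_eq[OF B(1) v(1) B(2)] by simp
  have "(\<Sum>b\<in>B. scale (\<phi> b * (e b - r)) b) = T v - scale r v"
    by (subst (1 2) v_eq)
      (simp add: T.sum T.scale e scale_sum_right algebra_simps flip: sum_subtractf)
  also have "\<dots> = 0"
    by (simp add: v(2))
  finally have zero: "\<phi> b * (e b - r) = 0" if "b \<in> B" for b
    using independentD[OF B(1) B(2) order_refl _ that, of "\<lambda>b. \<phi> b * (e b - r)"] by simp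
  have "v = (\<Sum>b | b \<in> B \<and> e b = r. scale (\<phi> b) b)"
    by (subst v_eq, rule sum.mono_neutral_right) (use B(2) zero in auto)
  also have "\<dots> \<in> span {b \<in> B. e b = r}"
    by (intro span_sum span_scale span_base) auto
  finally show ?thesis .
qed

lemma multiplicity_on_eigenbasis:
  assumes T: "module_hom scale scale T" and B: "independent B" "finite B"
    and e: "\<And>b. b \<in> B \<Longrightarrow> T b = scale (e b) b"
  shows "multiplicity_on (span B) T r = card {b \<in> B. e b = r}"
  unfolding multiplicity_on_def
proof (rule basis_card_eq_dim[symmetric])
  show "{b \<in> B. e b = r} \<subseteq> {v \<in> span B. T v = scale r v}"
    using e by (auto intro: span_base)
  show "{v \<in> span B. T v = scale r v} \<subseteq> span {b \<in> B. e b = r}"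
    using eigenspace_subset_span[OF T B e] by auto
  show "independent {b \<in> B. e b = r}"
    using B(1) by (rule independent_mono) auto
qed

lemma eigenvalue_on_eigenbasis:
  assumes T: "module_hom scale scale T" and B: "independent B" "finite B"
    and e: "\<And>b. b \<in> B \<Longrightarrow> T b = scale (e b) b"
  shows "eigenvalue_on (span B) T r \<longleftrightarrow> r \<in> e ` B"
proof
  assume "eigenvalue_on (span B) T r"
  then obtain v where v: "v \<in> span B" "v \<noteq> 0" "T v = scale r v"
    by (auto simp: eigenvalue_on_def)
  with eigenspace_subset_span[OF T B e, of v r] have "{b \<in> B. e b = r} \<noteq> {}"
    by force
  then show "r \<in> e ` B" by auto
next
  assume "r \<in> e ` B"
  then obtain b where "b \<in> B" "r = e b" by auto
  moreover from this B(1) have "b \<noteq> 0"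
    using dependent_zero by auto
  ultimately show "eigenvalue_on (span B) T r"
    using e by (auto simp: eigenvalue_on_def intro: span_base)
qed

end

section \<open>The group ring as a finite-dimensional function space, and traces on it\<close>

lemma sum_fun_apply: "(\<Sum>i\<in>I. f i) x = (\<Sum>i\<in>I. f i x)"
  for f :: "'i \<Rightarrow> 'a \<Rightarrow> 'b::comm_monoid_add"
  by (induction I rule: infinite_finite_induct) auto

lemma subspace_group_ring: "fun_space.subspace (group_ring G)"
  by (auto simp: fun_space.subspace_def group_ring_def fun_scale_def)

lemma gr_of_in_group_ring: "g \<in> carrier G \<Longrightarrow> gr_of g \<in> group_ring G"
  by (auto simp: gr_of_def group_ring_def)

lemma group_ring_expand:
  fixes a :: "'g \<Rightarrow> 'k::field"
  assumes "finite (carrier G)" and "a \<in> group_ring G"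
  shows "a = (\<Sum>g\<in>carrier G. fun_scale (a g) (gr_of g))"
proof
  fix x
  have "(\<Sum>g\<in>carrier G. fun_scale (a g) (gr_of g)) x = (\<Sum>g\<in>carrier G. if x = g then a g else 0)"
    by (simp add: sum_fun_apply fun_scale_def gr_of_def if_distrib cong: if_cong)
  also have "\<dots> = a x"
    using assms by (auto simp: group_ring_def)
  finally show "a x = (\<Sum>g\<in>carrier G. fun_scale (a g) (gr_of g)) x" by simp
qed

lemma finite_independent_group_ring:
  fixes B :: "('g \<Rightarrow> 'k::field) set"
  assumes "finite (carrier G)" and "fun_space.independent B" and "B \<subseteq> group_ring G"
  shows "finite B"
proof -
  have "a \<in> fun_space.span (gr_of ` carrier G)" if "a \<in> group_ring G" for a :: "'g \<Rightarrow> 'k"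
    by (subst group_ring_expand[OF assms(1) that])
      (intro fun_space.span_sum fun_space.span_scale fun_space.span_base imageI)
  then show ?thesis
    using assms fun_space.independent_span_bound[of "gr_of ` carrier G" B] by blast
qed

text \<open>Basis independence of the trace: the left side is the trace in the basis of group
  elements, the right side the trace in the eigenbasis B. It is obtained by expanding each group
  element in B, applying T and exchanging the sums.\<close>

lemma trace_eigenbasis:
  fixes T :: "('g \<Rightarrow> 'k::field) \<Rightarrow> 'g \<Rightarrow> 'k"
  assumes T: "module_hom fun_scale fun_scale T" and G: "finite (carrier G)"
    and B: "fun_space.independent B" "fun_space.span B = group_ring G"
    and e: "\<And>b. b \<in> B \<Longrightarrow> T b = fun_scale (e b) b"
  shows "(\<Sum>g\<in>carrier G. T (gr_of g) g) = (\<Sum>b\<in>B. e b)"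
proof -
  interpret T: module_hom fun_scale fun_scale T by fact
  let ?\<phi> = "fun_space.representation B"
  have BG: "B \<subseteq> group_ring G"
    using B(2) fun_space.span_base by blast
  then have fin: "finite B"
    using finite_independent_group_ring[OF G B(1)] by blast
  have in_span: "gr_of g \<in> fun_space.span B" if "g \<in> carrier G" for g
    using gr_of_in_group_ring[OF that] B(2) by auto
  have "T (gr_of g) g = (\<Sum>b\<in>B. e b * (b g * ?\<phi> (gr_of g) b))" if "g \<in> carrier G" for g
  proof -
    have "T (gr_of g) g = T (\<Sum>b\<in>B. fun_scale (?\<phi> (gr_of g) b) b) g"
      using fun_space.sum_representation_eq[OF B(1) in_span[OF that] fin] by simp
    also have "\<dots> = (\<Sum>b\<in>B. e b * (b g * ?\<phi> (gr_of g) b))"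
      by (simp add: T.sum T.scale sum_fun_apply e) (simp add: fun_scale_def algebra_simps)
    finally show ?thesis .
  qed
  then have "(\<Sum>g\<in>carrier G. T (gr_of g) g)
      = (\<Sum>g\<in>carrier G. \<Sum>b\<in>B. e b * (b g * ?\<phi> (gr_of g) b))"
    by (intro sum.cong) auto
  also have "\<dots> = (\<Sum>b\<in>B. e b * (\<Sum>g\<in>carrier G. b g * ?\<phi> (gr_of g) b))"
    by (subst sum.swap) (simp add: sum_distrib_left)
  \<comment> \<open>Since b is the sum of the b g times g, linearity of the coordinates turns the
    inner sum into the b-coordinate of b itself, which is 1.\<close>
  also have "\<dots> = (\<Sum>b\<in>B. e b * ?\<phi> b b)"
  proof (intro sum.cong refl arg_cong2[of _ _ _ _ "(*)"])
    fix b assume b: "b \<in> B"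
    have "?\<phi> b b = ?\<phi> (\<Sum>g\<in>carrier G. fun_scale (b g) (gr_of g)) b"
      using group_ring_expand[OF G, of b] BG b by auto
    also have "\<dots> = (\<Sum>g\<in>carrier G. b g * ?\<phi> (gr_of g) b)"
      using in_span B(1)
      by (subst fun_space.representation_sum)
        (auto simp: fun_space.representation_scale fun_space.span_scale)
    finally show "(\<Sum>g\<in>carrier G. b g * ?\<phi> (gr_of g) b) = ?\<phi> b b" ..
  qed
  also have "\<dots> = (\<Sum>b\<in>B. e b)"
    by (intro sum.cong) (auto simp: fun_space.representation_basis[OF B(1)])
  finally show ?thesis .
qed

text \<open>Triangularity: in the a-th moment the terms with i < a vanish and the term i = a has
  coefficient 1. Descending from a = n, the terms with i > a already agree and cancel.\<close>

lemma eq_if_binomial_moments_eq: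
  fixes \<mu> \<nu> :: "nat \<Rightarrow> nat"
  assumes "\<And>a. a \<le> n \<Longrightarrow> (\<Sum>i\<le>n. \<mu> i * (i choose a)) = (\<Sum>i\<le>n. \<nu> i * (i choose a))"
    and "a \<le> n"
  shows "\<mu> a = \<nu> a"
  using assms(2)
proof (induction "n - a" arbitrary: a rule: less_induct)
  case less
  have split: "(\<Sum>i\<le>n. f i * (i choose a)) = f a + (\<Sum>i\<in>{a<..n}. f i * (i choose a))" for f :: "nat \<Rightarrow> nat"
  proof -
    have "(\<Sum>i\<le>n. f i * (i choose a)) = (\<Sum>i\<in>insert a {a<..n}. f i * (i choose a))"
      using less.prems by (intro sum.mono_neutral_right) (auto simp: binomial_eq_0)
    then show ?thesis by simp
  qed
  have "(\<Sum>i\<in>{a<..n}. \<mu> i * (i choose a)) = (\<Sum>i\<in>{a<..n}. \<nu> i * (i choose a))"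
    using less.hyps by (intro sum.cong) auto
  with assms(1)[OF less.prems] show ?case
    by (simp add: split)
qed

section \<open>Convolution in a group ring\<close>

text \<open>Solving g h = x for g leaves a single sum. In this form a property of the left factor
  needs to be known only at the points x h^(-1).\<close>

lemma gr_mult_eq:
  assumes "group G" and fin: "finite (carrier G)"
  shows "gr_mult G a b x =
    (if x \<in> carrier G then \<Sum>h\<in>carrier G. a (x \<otimes>\<^bsub>G\<^esub> inv\<^bsub>G\<^esub> h) * b h else 0)"
proof -
  interpret group G by fact
  show ?thesis
  proof (cases "x \<in> carrier G")
    case True
    have "gr_mult G a b x = (\<Sum>h\<in>carrier G. \<Sum>g\<in>carrier G. if g = x \<otimes>\<^bsub>G\<^esub> inv\<^bsub>G\<^esub> h then a g * b h else 0)"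
      unfolding gr_mult_def using True
      by (subst sum.swap, intro sum.cong refl if_cong) (auto simp: inv_solve_right)
    also have "\<dots> = (\<Sum>h\<in>carrier G. a (x \<otimes>\<^bsub>G\<^esub> inv\<^bsub>G\<^esub> h) * b h)"
      using fin True by (intro sum.cong refl) (simp add: sum.delta)
    finally show ?thesis using True by simp
  qed (auto simp: gr_mult_def intro!: sum.neutral)
qed

lemma gr_mult_sum_gr_of:
  assumes "group G" and fin: "finite (carrier G)"
    and "\<And>i. i \<in> I \<Longrightarrow> s i \<in> carrier G" and "\<And>j. j \<in> J \<Longrightarrow> t j \<in> carrier G"
  shows "gr_mult G (\<Sum>i\<in>I. gr_of (s i)) (\<Sum>j\<in>J. gr_of (t j))
    = (\<Sum>i\<in>I. \<Sum>j\<in>J. gr_of (s i \<otimes>\<^bsub>G\<^esub> t j))"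
proof
  fix x
  interpret group G by fact
  have *: "(\<Sum>g\<in>carrier G. \<Sum>h\<in>carrier G. if g \<otimes>\<^bsub>G\<^esub> h = x then gr_of (s i) g * gr_of (t j) h else 0)
      = gr_of (s i \<otimes>\<^bsub>G\<^esub> t j) x" if "i \<in> I" "j \<in> J" for i j
  proof -
    have "(\<Sum>g\<in>carrier G. \<Sum>h\<in>carrier G. if g \<otimes>\<^bsub>G\<^esub> h = x then gr_of (s i) g * gr_of (t j) h else 0)
      = (\<Sum>g\<in>carrier G. if g = s i then \<Sum>h\<in>carrier G. if h = t j then
          (if g \<otimes>\<^bsub>G\<^esub> h = x then 1 else 0) else 0 else 0)"
      by (intro sum.cong refl) (auto simp: gr_of_def intro!: sum.cong sum.neutral)
    then show ?thesis
      using that assms by (simp add: sum.delta gr_of_def eq_commute)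
  qed
  have "gr_mult G (\<Sum>i\<in>I. gr_of (s i)) (\<Sum>j\<in>J. gr_of (t j)) x
    = (\<Sum>g\<in>carrier G. \<Sum>h\<in>carrier G. \<Sum>i\<in>I. \<Sum>j\<in>J.
        if g \<otimes>\<^bsub>G\<^esub> h = x then gr_of (s i) g * gr_of (t j) h else 0)"
    unfolding gr_mult_def by (intro sum.cong refl) (simp add: sum_fun_apply sum_product)
  also have "\<dots> = (\<Sum>i\<in>I. \<Sum>j\<in>J. \<Sum>g\<in>carrier G. \<Sum>h\<in>carrier G.
        if g \<otimes>\<^bsub>G\<^esub> h = x then gr_of (s i) g * gr_of (t j) h else 0)"
    by (subst (2) sum.swap, subst (1) sum.swap, subst (3) sum.swap, subst (2) sum.swap) (rule refl)
  also have "\<dots> = (\<Sum>i\<in>I. \<Sum>j\<in>J. gr_of (s i \<otimes>\<^bsub>G\<^esub> t j)) x"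
    by (simp add: sum_fun_apply *)
  finally show "gr_mult G (\<Sum>i\<in>I. gr_of (s i)) (\<Sum>j\<in>J. gr_of (t j)) x
    = (\<Sum>i\<in>I. \<Sum>j\<in>J. gr_of (s i \<otimes>\<^bsub>G\<^esub> t j)) x" .
qed

section \<open>Equivariant permutations\<close>

text \<open>The reflection group over an arbitrary set X of positions. The generality serves the
  count of fixed points, where the elements fixing A are the group over X - A. The neutral colour is
  written \<open>0\<close>, and colours are added modulo m.\<close>

definition equivariant_perms :: "nat \<Rightarrow> nat set \<Rightarrow> (nat \<times> int \<Rightarrow> nat \<times> int) set"
  where "equivariant_perms m X = {\<pi>. \<pi> permutes X \<times> {0..<int m} \<and>
    (\<forall>x\<in>X. \<forall>\<rho>\<in>{0..<int m}. \<pi> (x, \<rho>) = act m \<rho> (\<pi> (x, 0)))}"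

lemma act_simps [simp]:
  "act m \<rho> (x, \<sigma>) = (x, (\<rho> + \<sigma>) mod int m)" "fst (act m \<rho> p) = fst p"
  "act m \<rho> (act m \<sigma> p) = act m ((\<rho> + \<sigma>) mod int m) p"
  by (auto simp: act_def mod_simps add.assoc)

lemma carrier_refl_group:
  "0 < m \<Longrightarrow> carrier (refl_group m n) = equivariant_perms m {1..n}"
  by (simp add: refl_group_def equivariant_perms_def pts_def carrier_integer_mod_group)

lemma mult_refl_group [simp]: "g \<otimes>\<^bsub>refl_group m n\<^esub> h = g \<circ> h"
  and one_refl_group [simp]: "\<one>\<^bsub>refl_group m n\<^esub> = id"
  by (simp_all add: refl_group_def)

lemma equivariant_permsD:
  assumes "\<pi> \<in> equivariant_perms m X"
  shows "\<pi> permutes X \<times> {0..<int m}" 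
    and "x \<in> X \<Longrightarrow> \<rho> \<in> {0..<int m} \<Longrightarrow> \<pi> (x, \<rho>) = act m \<rho> (\<pi> (x, 0))"
  using assms unfolding equivariant_perms_def by blast+

lemma equivariant_perms_act:
  assumes "0 < m" and \<pi>: "\<pi> \<in> equivariant_perms m X" and p: "p \<in> X \<times> {0..<int m}"
  shows "\<pi> (act m \<sigma> p) = act m \<sigma> (\<pi> p)"
proof -
  obtain x \<rho> where [simp]: "p = (x, \<rho>)" by (cases p)
  have "\<pi> (act m \<sigma> p) = act m ((\<sigma> + \<rho>) mod int m) (\<pi> (x, 0))"
    using equivariant_permsD(2)[OF \<pi>, of x "(\<sigma> + \<rho>) mod int m"] assms by simp
  also have "\<dots> = act m \<sigma> (act m \<rho> (\<pi> (x, 0)))"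
    by simp
  also have "\<dots> = act m \<sigma> (\<pi> p)"
    using equivariant_permsD(2)[OF \<pi>, of x \<rho>] p by simp
  finally show ?thesis .
qed

lemma equivariant_perms_range:
  assumes "\<pi> \<in> equivariant_perms m X" and "x \<in> X" and "0 < m"
  shows "\<pi> (x, 0) \<in> X \<times> {0..<int m}" "fst (\<pi> (x, 0)) \<in> X"
    "snd (\<pi> (x, 0)) \<in> {0..<int m}"
proof -
  show *: "\<pi> (x, 0) \<in> X \<times> {0..<int m}"
    using permutes_in_image[OF equivariant_permsD(1)[OF assms(1)]] assms(2,3) by simp
  show "fst (\<pi> (x, 0)) \<in> X" "snd (\<pi> (x, 0)) \<in> {0..<int m}"
    using * by (simp_all add: mem_Times_iff)
qed

text \<open>Rotating \<open>(z, 0)\<close> by minus the colour of its image gives a point whose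
  image has colour 0. If x and y had images at the same position, the two rotated points would have
  the same image. The negative colour is harmless, as \<open>act\<close> reduces modulo m.\<close>

lemma inj_on_fst_equivariant_perms:
  assumes "0 < m" and \<pi>: "\<pi> \<in> equivariant_perms m X"
  shows "inj_on (\<lambda>x. fst (\<pi> (x, 0))) X"
proof (rule inj_onI)
  fix x y assume xy: "x \<in> X" "y \<in> X" and eq: "fst (\<pi> (x, 0)) = fst (\<pi> (y, 0))"
  have *: "\<pi> (act m (- snd (\<pi> (z, 0))) (z, 0)) = (fst (\<pi> (z, 0)), 0)" if "z \<in> X" for z
    using that assms(1) by (subst equivariant_perms_act[OF assms]) (auto simp: act_def)
  have "\<pi> (act m (- snd (\<pi> (x, 0))) (x, 0)) = \<pi> (act m (- snd (\<pi> (y, 0))) (y, 0))"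
    using *[OF xy(1)] *[OF xy(2)] eq by simp
  then show "x = y"
    using permutes_inj[OF equivariant_permsD(1)[OF \<pi>]] by (simp add: inj_eq)
qed

lemma equivariant_perms_eqI:
  assumes "\<pi> \<in> equivariant_perms m X" "\<pi>' \<in> equivariant_perms m X"
    and "\<And>x. x \<in> X \<Longrightarrow> \<pi> (x, 0) = \<pi>' (x, 0)"
  shows "\<pi> = \<pi>'"
proof
  fix p
  show "\<pi> p = \<pi>' p"
  proof (cases "p \<in> X \<times> {0..<int m}")
    case True
    then obtain x \<rho> where "p = (x, \<rho>)" "x \<in> X" "\<rho> \<in> {0..<int m}" by auto
    then show ?thesis
      using equivariant_permsD(2)[OF assms(1)] equivariant_permsD(2)[OF assms(2)] assms(3) by metis
  next
    case False
    then show ?thesis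
      using permutes_not_in[OF equivariant_permsD(1)] assms(1,2) by metis
  qed
qed

lemma id_equivariant_perms: "id \<in> equivariant_perms m X"
  by (auto simp: equivariant_perms_def)

lemma comp_equivariant_perms:
  assumes "0 < m" and g: "g \<in> equivariant_perms m X" and h: "h \<in> equivariant_perms m X"
  shows "g \<circ> h \<in> equivariant_perms m X"
  unfolding equivariant_perms_def
proof (intro CollectI conjI ballI)
  show "g \<circ> h permutes X \<times> {0..<int m}"
    using equivariant_permsD(1)[OF g] equivariant_permsD(1)[OF h] by (intro permutes_compose)
  fix x \<rho> assume x: "x \<in> X" and r: "\<rho> \<in> {0..<int m}"
  show "(g \<circ> h) (x, \<rho>) = act m \<rho> ((g \<circ> h) (x, 0))"
    using equivariant_permsD(2)[OF h x r] equivariant_perms_act[OF assms(1) g]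
      equivariant_perms_range(1)[OF h x assms(1)] by simp
qed

lemma inv_equivariant_perms:
  assumes "0 < m" and g: "g \<in> equivariant_perms m X"
  shows "inv_into UNIV g \<in> equivariant_perms m X"
  unfolding equivariant_perms_def
proof (intro CollectI conjI ballI)
  note P = equivariant_permsD(1)[OF g]
  show I: "inv_into UNIV g permutes X \<times> {0..<int m}"
    using P by (rule permutes_inv)
  fix x \<rho> assume x: "x \<in> X" and r: "\<rho> \<in> {0..<int m}"
  have "inv_into UNIV g (x, 0) \<in> X \<times> {0..<int m}"
    using permutes_in_image[OF I] x assms(1) by simp
  then have "g (act m \<rho> (inv_into UNIV g (x, 0))) = act m \<rho> (g (inv_into UNIV g (x, 0)))"
    by (rule equivariant_perms_act[OF assms])
  also have "\<dots> = (x, \<rho>)"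
    using r by (simp add: permutes_inverses(1)[OF P])
  finally show "inv_into UNIV g (x, \<rho>) = act m \<rho> (inv_into UNIV g (x, 0))"
    using permutes_inv_eq[OF P] by blast
qed

lemma finite_equivariant_perms: "finite X \<Longrightarrow> finite (equivariant_perms m X)"
  by (rule finite_subset[of _ "{\<pi>. \<pi> permutes X \<times> {0..<int m}}"])
    (auto simp: equivariant_perms_def finite_permutations)

lemma group_refl_group:
  assumes "0 < m"
  shows "group (refl_group m n)"
proof (rule groupI)
  fix g assume "g \<in> carrier (refl_group m n)"
  then have g: "g \<in> equivariant_perms m {1..n}"
    by (simp add: carrier_refl_group assms)
  then have "inv_into UNIV g \<circ> g = id"
    using permutes_inv_o(2)[OF equivariant_permsD(1)] by blast
  then show "\<exists>h\<in>carrier (refl_group m n). h \<otimes>\<^bsub>refl_group m n\<^esub> g = \<one>\<^bsub>refl_group m n\<^esub>"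
    using inv_equivariant_perms[OF assms g] by (auto simp: carrier_refl_group assms)
qed (use assms in \<open>auto simp: carrier_refl_group comp_equivariant_perms id_equivariant_perms comp_assoc\<close>)

lemma finite_refl_group: "0 < m \<Longrightarrow> finite (carrier (refl_group m n))"
  by (simp add: carrier_refl_group finite_equivariant_perms)

lemma inv_refl_group:
  assumes "0 < m" and g: "g \<in> carrier (refl_group m n)"
  shows "inv\<^bsub>refl_group m n\<^esub> g = inv_into UNIV g"
proof (rule group.inv_equality[OF group_refl_group[OF assms(1)] _ g])
  have g: "g \<in> equivariant_perms m {1..n}"
    using g by (simp add: carrier_refl_group assms)
  show "inv_into UNIV g \<otimes>\<^bsub>refl_group m n\<^esub> g = \<one>\<^bsub>refl_group m n\<^esub>"
    using permutes_inv_o(2)[OF equivariant_permsD(1)[OF g]] by simp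
  show "inv_into UNIV g \<in> carrier (refl_group m n)"
    using inv_equivariant_perms[OF assms(1) g] by (simp add: carrier_refl_group assms)
qed

section \<open>Elements given by the images of the base points\<close>

lemma equivariant_map_apply:
  assumes "0 < m" and "x \<in> {1..n}" and "c \<in> {0..<int m}"
  shows "equivariant_map m n f (x, c) = act m c (f x)"
  using assms by (simp add: equivariant_map_def pts_def carrier_integer_mod_group)

lemma equivariant_map_cong:
  "(\<And>x. x \<in> {1..n} \<Longrightarrow> f x = f' x) \<Longrightarrow> equivariant_map m n f = equivariant_map m n f'"
  by (auto simp: equivariant_map_def pts_def fun_eq_iff)

text \<open>Only the positions must form a permutation; the colours of f are free. Equal images have
  equal positions, which gives equal x, and then the common colour of f x cancels modulo m.
  Finiteness turns injectivity into bijectivity.\<close>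

lemma equivariant_map_in_equivariant_perms:
  assumes m: "0 < m" and bij: "bij_betw (fst \<circ> f) {1..n} {1..n}"
  shows "equivariant_map m n f \<in> equivariant_perms m {1..n}"
  unfolding equivariant_perms_def
proof (intro CollectI conjI ballI)
  let ?g = "equivariant_map m n f" and ?E = "{1..n} \<times> {0..<int m}"
  show "?g (x, \<rho>) = act m \<rho> (?g (x, 0))" if "x \<in> {1..n}" "\<rho> \<in> {0..<int m}" for x \<rho>
    using that m by (simp add: equivariant_map_apply)
  have into: "?g ` ?E \<subseteq> ?E"
  proof (rule image_subsetI)
    fix p assume "p \<in> ?E"
    then obtain x c where p: "p = (x, c)" and x: "x \<in> {1..n}" "c \<in> {0..<int m}"
      by blast
    have "fst (f x) \<in> {1..n}"
      using bij_betw_apply[OF bij x(1)] by simp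
    then show "?g p \<in> ?E"
      unfolding p using m x by (simp add: equivariant_map_apply act_def)
  qed
  have "inj_on ?g ?E"
  proof (rule inj_onI)
    fix p q assume "p \<in> ?E" "q \<in> ?E" and eq: "?g p = ?g q"
    then obtain x c y d where p: "p = (x, c)" "q = (y, d)"
      and x: "x \<in> {1..n}" "c \<in> {0..<int m}" and y: "y \<in> {1..n}" "d \<in> {0..<int m}"
      by blast
    from eq p have eq': "act m c (f x) = act m d (f y)"
      using m x y by (simp add: equivariant_map_apply)
    from arg_cong[OF this, of fst] have "(fst \<circ> f) x = (fst \<circ> f) y"
      by simp
    then have "x = y"
      using inj_onD[OF bij_betw_imp_inj_on[OF bij]] x(1) y(1) by blast
    moreover from eq' this have "(c + snd (f x)) mod int m = (d + snd (f x)) mod int m"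
      by (simp add: act_def)
    then have "c mod int m = d mod int m"
      by (simp add: mod_eq_dvd_iff)
    ultimately show "p = q"
      using p x(2) y(2) by simp
  qed
  then have "bij_betw ?g ?E ?E"
    using endo_inj_surj[OF _ into] by (simp add: bij_betw_def)
  then show "?g permutes ?E"
    by (rule bij_imp_permutes)
      (use m in \<open>auto simp: equivariant_map_def pts_def carrier_integer_mod_group\<close>)
qed

text \<open>The multiplication rule of the wreath product: positions compose and colours add along
  the way.\<close>

lemma comp_equivariant_map:
  assumes "0 < m" and "\<And>x. x \<in> {1..n} \<Longrightarrow> fst (g x) \<in> {1..n}"
  shows "equivariant_map m n f \<circ> equivariant_map m n g
    = equivariant_map m n (\<lambda>x. act m (snd (g x)) (f (fst (g x))))"
proof
  fix p
  show "(equivariant_map m n f \<circ> equivariant_map m n g) p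
    = equivariant_map m n (\<lambda>x. act m (snd (g x)) (f (fst (g x)))) p"
  proof (cases "p \<in> pts m n")
    case True
    obtain x c where p: "p = (x, c)" and x: "x \<in> {1..n}"
      using True by (auto simp: pts_def)
    let ?q = "(fst (g x), (c + snd (g x)) mod int m)"
    have "act m c (g x) = ?q"
      by (simp add: act_def)
    moreover have "?q \<in> pts m n"
      using assms(1) assms(2)[OF x] by (simp add: pts_def carrier_integer_mod_group)
    ultimately show ?thesis
      using True unfolding p by (simp add: equivariant_map_def)
  qed (simp add: equivariant_map_def)
qed

lemma equivariant_map_id: "equivariant_map m n (\<lambda>x. (x, 0)) = id" if "0 < m"
  using that by (auto simp: equivariant_map_def pts_def carrier_integer_mod_group)

section \<open>The terms of the shuffle element\<close>

text \<open>\<open>insertion m n k \<rho>\<close> is \<open>s\<^sub>k \<dots> s\<^sub>n\<^sub>-\<^sub>1 t\<^sub>n\<^sup>j\<close> with \<open>\<rho> = \<gamma>\<^sup>j\<close>.\<close>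

definition insertion :: "nat \<Rightarrow> nat \<Rightarrow> nat \<Rightarrow> int \<Rightarrow> nat \<times> int \<Rightarrow> nat \<times> int"
  where "insertion m n k \<rho> =
    equivariant_map m n (\<lambda>x. if x = n then (k, \<rho>) else (if x < k then x else x + 1, 0))"

lemma insertion_in_equivariant_perms:
  assumes "0 < m" and "k \<in> {1..n}" and "\<rho> \<in> {0..<int m}"
  shows "insertion m n k \<rho> \<in> equivariant_perms m {1..n}"
  unfolding insertion_def
proof (rule equivariant_map_in_equivariant_perms[OF assms(1)])
  let ?f = "\<lambda>x. if x = n then (k, \<rho>) else (if x < k then x else x + 1, 0)"
  have inj: "inj_on (fst \<circ> ?f) {1..n}"
    by (auto simp: inj_on_def)
  have "(fst \<circ> ?f) ` {1..n} \<subseteq> {1..n}"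
    using assms(2) by auto
  then show "bij_betw (fst \<circ> ?f) {1..n} {1..n}"
    unfolding bij_betw_def using inj by (intro conjI endo_inj_surj) simp_all
qed

lemma insertion_apply:
  assumes "0 < m" and "x \<in> {1..n}" and "\<rho> \<in> {0..<int m}" and "c \<in> {0..<int m}"
  shows "insertion m n k \<rho> (x, c) = (if x = n then (k, (c + \<rho>) mod int m) else (if x < k then x else x + 1, c))"
  using assms by (simp add: insertion_def equivariant_map_apply)

text \<open>The word is the cycle that sends n to k and moves k, ..., n - 1 up by one. It grows at
  its left end, hence the induction downwards from the empty word at k = n: composing with
  \<open>s_elt m n k\<close> redirects n from k + 1 to k, and k to k + 1.\<close>

lemma s_word_eq_insertion:
  assumes "0 < m" and "k \<le> n" and "1 \<le> k"
  shows "s_word m n k = insertion m n k 0"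
  using assms(2,3)
proof (induction rule: inc_induct)
  case base
  have "equivariant_map m n (\<lambda>x. if x = n then (n, 0) else (if x < n then x else x + 1, 0))
      = equivariant_map m n (\<lambda>x. (x, 0))"
    by (rule equivariant_map_cong) auto
  with assms(1) show ?case
    by (simp add: s_word_def insertion_def equivariant_map_id)
next
  case (step k)
  have "s_word m n k = s_elt m n k \<circ> s_word m n (Suc k)"
    using upt_conv_Cons[OF step.hyps(2)] by (simp add: s_word_def)
  also have "s_word m n (Suc k) = insertion m n (Suc k) 0"
    by (rule step.IH) simp
  also have "s_elt m n k \<circ> insertion m n (Suc k) 0 = insertion m n k 0"
    unfolding s_elt_def insertion_def using step.hyps step.prems
    by (subst comp_equivariant_map[OF assms(1)], force, intro equivariant_map_cong)
      (auto simp: transpose_def)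
  finally show ?case .
qed

text \<open>Conjugation by the i-th transposition moves the recoloured position from i to i +
  1.\<close>

lemma ti_elt_eq:
  assumes "0 < m" and "\<gamma> \<in> {0..<int m}" and "Suc i \<le> n"
  shows "ti_elt m n \<gamma> (Suc i) = equivariant_map m n (\<lambda>x. (x, if x = Suc i then \<gamma> else 0))"
  using assms(3)
proof (induction i)
  case 0
  show ?case by (simp add: t_elt_def cong: if_cong)
next
  case (Suc i)
  have "ti_elt m n \<gamma> (Suc (Suc i)) = s_elt m n (Suc i) \<circ>
      equivariant_map m n (\<lambda>x. (x, if x = Suc i then \<gamma> else 0)) \<circ> s_elt m n (Suc i)"
    using Suc by simp
  also have "\<dots> = equivariant_map m n (\<lambda>x. (x, if x = Suc (Suc i) then \<gamma> else 0))"
    unfolding s_elt_def comp_assoc using assms(2) Suc.prems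
    by (subst comp_equivariant_map[OF assms(1)], force simp: transpose_def,
        subst comp_equivariant_map[OF assms(1)], force simp: transpose_def,
        intro equivariant_map_cong) (auto simp: transpose_def)
  finally show ?case .
qed

lemma ti_elt_pow:
  assumes "0 < m" and "\<gamma> \<in> {0..<int m}" and "1 \<le> n"
  shows "ti_elt m n \<gamma> n [^]\<^bsub>refl_group m n\<^esub> (j::nat)
    = equivariant_map m n (\<lambda>x. (x, if x = n then (int j * \<gamma>) mod int m else 0))"
proof (induction j)
  case 0
  have "(\<lambda>x. (x, if x = n then (int 0 * \<gamma>) mod int m else 0)) = (\<lambda>x. (x, 0))"
    by auto
  with assms(1) show ?case
    by (simp add: equivariant_map_id nat_pow_def)
next
  case (Suc j)
  interpret group "refl_group m n"
    using assms(1) by (rule group_refl_group)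
  have "ti_elt m n \<gamma> n = equivariant_map m n (\<lambda>x. (x, if x = n then \<gamma> else 0))"
    using assms ti_elt_eq[of m \<gamma> "n - 1" n] by simp
  then have "ti_elt m n \<gamma> n [^]\<^bsub>refl_group m n\<^esub> Suc j =
      equivariant_map m n (\<lambda>x. (x, if x = n then (int j * \<gamma>) mod int m else 0)) \<circ>
      equivariant_map m n (\<lambda>x. (x, if x = n then \<gamma> else 0))"
    using Suc by simp
  also have "\<dots> = equivariant_map m n (\<lambda>x. (x, if x = n then (int (Suc j) * \<gamma>) mod int m else 0))"
    using assms(1) by (subst comp_equivariant_map)
      (auto intro!: equivariant_map_cong simp: algebra_simps mod_simps)
  finally show ?case .
qed

text \<open>The generator property enters here. An integer exponent may be reduced modulo m, so the
  m multiples exhaust the m colours, and equality of the cardinalities gives injectivity.\<close>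

lemma bij_betw_generator_multiples:
  assumes "0 < m" and "\<gamma> \<in> carrier (cyc m)" and "generate (cyc m) {\<gamma>} = carrier (cyc m)"
  shows "bij_betw (\<lambda>j. (int j * \<gamma>) mod int m) {..<m} {0..<int m}"
proof -
  let ?f = "\<lambda>j. (int j * \<gamma>) mod int m"
  have C: "carrier (cyc m) = {0..<int m}"
    using assms(1) by (simp add: carrier_integer_mod_group)
  have "{0..<int m} \<subseteq> ?f ` {..<m}"
  proof
    fix \<rho> assume "\<rho> \<in> {0..<int m}"
    then have "\<rho> \<in> {\<gamma> [^]\<^bsub>cyc m\<^esub> k |k. k \<in> (UNIV :: int set)}"
      using group.generate_pow[OF group_integer_mod_group assms(2)] assms(3) C by blast
    then obtain k :: int where k: "\<rho> = (k * \<gamma>) mod int m"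
      by (auto simp: int_pow_integer_mod_group)
    have "\<rho> = ?f (nat (k mod int m))"
      using assms(1) by (simp add: k mod_simps)
    moreover have "nat (k mod int m) < m"
      using assms(1) by (simp add: nat_less_iff)
    ultimately show "\<rho> \<in> ?f ` {..<m}"
      by blast
  qed
  then have im: "?f ` {..<m} = {0..<int m}"
    using assms(1) by auto
  then have "inj_on ?f {..<m}"
    by (intro eq_card_imp_inj_on) auto
  with im show ?thesis
    by (simp add: bij_betw_def)
qed

text \<open>There is exactly one term for each possible image (k, \<rho>) of the last base point
  \<open>(n, 0)\<close>. The terms thus represent the left cosets of the stabilizer of that point,
  and the choice of \<gamma> disappears from the right side.\<close>

lemma shuffle_eq:
  assumes "0 < m" and "1 \<le> n"
    and "\<gamma> \<in> carrier (cyc m)" and "generate (cyc m) {\<gamma>} = carrier (cyc m)"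
  shows "shuffle m n \<gamma> = (\<Sum>k\<in>{1..n}. \<Sum>\<rho>\<in>{0..<int m}. gr_of (insertion m n k \<rho>))"
proof -
  let ?c = "\<lambda>j. (int j * \<gamma>) mod int m"
  let ?t = "\<lambda>j. ti_elt m n \<gamma> n [^]\<^bsub>refl_group m n\<^esub> (j::nat)"
  have \<gamma>: "\<gamma> \<in> {0..<int m}"
    using assms(1,3) by (simp add: carrier_integer_mod_group)
  note t = ti_elt_pow[OF assms(1) \<gamma> assms(2)]
  have "?t j \<in> carrier (refl_group m n)" for j
    unfolding t carrier_refl_group[OF assms(1)] using assms(1)
    by (intro equivariant_map_in_equivariant_perms) (auto simp: comp_def bij_betw_def)
  moreover have "s_word m n k \<in> carrier (refl_group m n)" if "k \<in> {1..n}" for k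
    using that assms(1) s_word_eq_insertion[OF assms(1), of k n]
      insertion_in_equivariant_perms[OF assms(1) that, of 0]
    unfolding carrier_refl_group[OF assms(1)] by simp
  ultimately have "shuffle m n \<gamma> = (\<Sum>k\<in>{1..n}. \<Sum>j<m. gr_of (s_word m n k \<circ> ?t j))"
    unfolding shuffle_def using assms(1)
    by (subst gr_mult_sum_gr_of) (auto simp: group_refl_group finite_refl_group)
  also have "\<dots> = (\<Sum>k\<in>{1..n}. \<Sum>j<m. gr_of (insertion m n k (?c j)))"
  proof (intro sum.cong refl arg_cong[of _ _ gr_of])
    fix k j assume "k \<in> {1..n}" "j \<in> {..<m}"
    then show "s_word m n k \<circ> ?t j = insertion m n k (?c j)"
      using assms(1) unfolding t
      by (simp add: s_word_eq_insertion, unfold insertion_def, subst comp_equivariant_map)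
        (auto intro!: equivariant_map_cong)
  qed
  also have "\<dots> = (\<Sum>k\<in>{1..n}. \<Sum>\<rho>\<in>{0..<int m}. gr_of (insertion m n k \<rho>))"
    by (intro sum.cong refl sum.reindex_bij_betw bij_betw_generator_multiples assms)
  finally show ?thesis .
qed

section \<open>Left multiplication by the shuffle element in coordinates\<close>

lemma module_hom_rat_extension: "module_hom fun_scale fun_scale (rat_extension G T)"
proof -
  have "vector_space (fun_scale :: rat \<Rightarrow> ('g \<Rightarrow> rat) \<Rightarrow> 'g \<Rightarrow> rat)"
    by (rule fun_space.vector_space_axioms)
  then show ?thesis
    by (auto simp: module_hom_iff module_iff_vector_space rat_extension_def fun_scale_def
        algebra_simps sum.distrib sum_distrib_left)
qed

text \<open>Left multiplication by a group element s translates coefficients: (s y)(x) = y (s^(-1)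
  x). The operator thereby becomes a sum of translates, one for each insertion.\<close>

lemma rat_extension_shuffle_op:
  fixes y :: "(nat \<times> int \<Rightarrow> nat \<times> int) \<Rightarrow> rat"
  assumes "0 < m" and "1 \<le> n"
    and "\<gamma> \<in> carrier (cyc m)" and "generate (cyc m) {\<gamma>} = carrier (cyc m)"
  shows "rat_extension (refl_group m n) (shuffle_op m n \<gamma>) y x =
    (if x \<in> carrier (refl_group m n)
     then \<Sum>k\<in>{1..n}. \<Sum>\<rho>\<in>{0..<int m}. y (inv_into UNIV (insertion m n k \<rho>) \<circ> x) else 0)"
proof (cases "x \<in> carrier (refl_group m n)")
  case True
  let ?G = "refl_group m n"
  let ?s = "insertion m n"
  interpret group ?G
    using assms(1) by (rule group_refl_group)
  have fin: "finite (carrier ?G)"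
    using assms(1) by (rule finite_refl_group)
  have s: "?s k \<rho> \<in> carrier ?G" if "k \<in> {1..n}" "\<rho> \<in> {0..<int m}" for k \<rho>
    unfolding carrier_refl_group[OF assms(1)]
    by (rule insertion_in_equivariant_perms[OF assms(1) that])
  have *: "shuffle_op m n \<gamma> (gr_of g) x =
      (\<Sum>k\<in>{1..n}. \<Sum>\<rho>\<in>{0..<int m}. if g = inv_into UNIV (?s k \<rho>) \<circ> x then 1 else 0)"
    if g: "g \<in> carrier ?G" for g
  proof -
    have "shuffle_op m n \<gamma> (gr_of g) x
        = (\<Sum>h\<in>carrier ?G. shuffle m n \<gamma> (x \<otimes>\<^bsub>?G\<^esub> inv\<^bsub>?G\<^esub> h) * (if h = g then 1 else 0))"
      unfolding shuffle_op_def gr_mult_eq[OF is_group fin] using True by (simp add: gr_of_def)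
    also have "\<dots> = shuffle m n \<gamma> (x \<otimes>\<^bsub>?G\<^esub> inv\<^bsub>?G\<^esub> g)"
      using g fin by (simp add: if_distrib sum.delta cong: if_cong)
    also have "\<dots> = (\<Sum>k\<in>{1..n}. \<Sum>\<rho>\<in>{0..<int m}. if x \<otimes>\<^bsub>?G\<^esub> inv\<^bsub>?G\<^esub> g = ?s k \<rho> then 1 else 0)"
      by (simp add: shuffle_eq[OF assms] sum_fun_apply gr_of_def)
    also have "\<dots> = (\<Sum>k\<in>{1..n}. \<Sum>\<rho>\<in>{0..<int m}. if g = inv_into UNIV (?s k \<rho>) \<circ> x then 1 else 0)"
    proof (intro sum.cong refl if_cong)
      fix k \<rho> assume k: "k \<in> {1..n}" "\<rho> \<in> {0..<int m}"
      have "x \<otimes>\<^bsub>?G\<^esub> inv\<^bsub>?G\<^esub> g = ?s k \<rho> \<longleftrightarrow> g = inv\<^bsub>?G\<^esub> (?s k \<rho>) \<otimes>\<^bsub>?G\<^esub> x"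
        using inv_solve_right[OF s[OF k] True g] inv_solve_left[OF g s[OF k] True]
        by metis
      also have "\<dots> \<longleftrightarrow> g = inv_into UNIV (?s k \<rho>) \<circ> x"
        using s[OF k] by (simp add: inv_refl_group[OF assms(1)])
      finally show "x \<otimes>\<^bsub>?G\<^esub> inv\<^bsub>?G\<^esub> g = ?s k \<rho> \<longleftrightarrow> g = inv_into UNIV (?s k \<rho>) \<circ> x" .
    qed
    finally show ?thesis .
  qed
  have "rat_extension ?G (shuffle_op m n \<gamma>) y x
      = (\<Sum>g\<in>carrier ?G. \<Sum>k\<in>{1..n}. \<Sum>\<rho>\<in>{0..<int m}. if g = inv_into UNIV (?s k \<rho>) \<circ> x then y g else 0)"
    unfolding rat_extension_def
    by (intro sum.cong refl) (simp add: * sum_distrib_left if_distrib cong: if_cong)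
  also have "\<dots> = (\<Sum>k\<in>{1..n}. \<Sum>\<rho>\<in>{0..<int m}. \<Sum>g\<in>carrier ?G. if g = inv_into UNIV (?s k \<rho>) \<circ> x then y g else 0)"
    by (subst sum.swap, subst (2) sum.swap) (rule refl)
  also have "\<dots> = (\<Sum>k\<in>{1..n}. \<Sum>\<rho>\<in>{0..<int m}. y (inv_into UNIV (?s k \<rho>) \<circ> x))"
  proof (intro sum.cong refl)
    fix k \<rho> assume k: "k \<in> {1..n}" "\<rho> \<in> {0..<int m}"
    have "inv_into UNIV (?s k \<rho>) \<circ> x \<in> carrier ?G"
      using m_closed[OF inv_closed[OF s[OF k]] True] s[OF k] by (simp add: inv_refl_group[OF assms(1)])
    then show "(\<Sum>g\<in>carrier ?G. if g = inv_into UNIV (?s k \<rho>) \<circ> x then y g else 0) = y (inv_into UNIV (?s k \<rho>) \<circ> x)"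
      using fin by simp
  qed
  finally show ?thesis using True by simp
next
  case False
  then show ?thesis
    by (simp add: rat_extension_def shuffle_op_def gr_mult_eq group_refl_group finite_refl_group assms(1))
qed

section \<open>The eigenvalue recursion\<close>

text \<open>The support of the group ring element \<open>R\<^sub>b\<close> from the introduction.\<close>

definition ordered_prefix :: "nat \<Rightarrow> nat \<Rightarrow> nat \<Rightarrow> (nat \<times> int \<Rightarrow> nat \<times> int) set"
  where "ordered_prefix m n b = {h \<in> equivariant_perms m {1..n}.
    (\<forall>y\<in>{1..b}. snd (h (y, 0)) = 0) \<and> strict_mono_on {1..b} (\<lambda>y. fst (h (y, 0)))}"

lemma ordered_prefix_antimono: "b \<le> c \<Longrightarrow> ordered_prefix m n c \<subseteq> ordered_prefix m n b"
  by (auto simp: ordered_prefix_def strict_mono_on_def)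

text \<open>Each step raises f by at least 1. Climbing from 1 \<le> f 1 gives x \<le> f x, and
  descending from f n \<le> n gives f x \<le> x.\<close>

lemma strict_mono_on_interval_eq_id:
  fixes f :: "nat \<Rightarrow> nat"
  assumes f: "strict_mono_on {1..n} f" and into: "\<And>x. x \<in> {1..n} \<Longrightarrow> f x \<in> {1..n}"
    and x: "x \<in> {1..n}"
  shows "f x = x"
proof (rule antisym)
  have less: "f y < f (Suc y)" if "1 \<le> y" "y < n" for y
    using that by (intro strict_mono_onD[OF f]) auto
  have "1 \<le> x" "x \<le> n" using x by auto
  then show "x \<le> f x"
  proof (induction rule: dec_induct)
    case base
    then show ?case using into[of 1] by simp
  next
    case (step y)
    then show ?case using less[of y] by simp
  qed
  from \<open>x \<le> n\<close> \<open>1 \<le> x\<close> show "f x \<le> x"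
  proof (induction rule: inc_induct)
    case base
    then show ?case using into[of n] by simp
  next
    case (step y)
    then show ?case using less[of y] by simp
  qed
qed

lemma ordered_prefix_n:
  assumes "0 < m"
  shows "ordered_prefix m n n = {id}"
proof
  show "{id} \<subseteq> ordered_prefix m n n"
    by (auto simp: ordered_prefix_def id_equivariant_perms strict_mono_on_def)
  show "ordered_prefix m n n \<subseteq> {id}"
  proof
    fix h assume "h \<in> ordered_prefix m n n"
    then have h: "h \<in> equivariant_perms m {1..n}" "\<And>y. y \<in> {1..n} \<Longrightarrow> snd (h (y, 0)) = 0"
      and mono: "strict_mono_on {1..n} (\<lambda>y. fst (h (y, 0)))"
      by (auto simp: ordered_prefix_def)
    have "h (y, 0) = id (y, 0)" if "y \<in> {1..n}" for y
      using strict_mono_on_interval_eq_id[OF mono equivariant_perms_range(2)[OF h(1) _ assms] that]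
        h(2)[OF that] by (simp add: prod_eq_iff)
    then show "h \<in> {id}"
      using equivariant_perms_eqI[OF h(1) id_equivariant_perms] by simp
  qed
qed

text \<open>Away from position n an insertion keeps colours and acts on positions as the increasing
  map that skips k. It therefore neither creates nor destroys an ordered prefix whose images avoid
  n.\<close>

lemma insertion_comp_in_ordered_prefix_iff:
  assumes m: "0 < m" and k: "k \<in> {1..n}" and \<rho>: "\<rho> \<in> {0..<int m}"
    and h: "h \<in> equivariant_perms m {1..n}" and c: "c \<le> n"
    and ne: "\<And>y. y \<in> {1..c} \<Longrightarrow> fst (h (y, 0)) \<noteq> n"
  shows "insertion m n k \<rho> \<circ> h \<in> ordered_prefix m n c \<longleftrightarrow> h \<in> ordered_prefix m n c"
proof -
  let ?skip = "\<lambda>x. if x < k then x else x + 1"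
  have *: "(insertion m n k \<rho> \<circ> h) (y, 0) = (?skip (fst (h (y, 0))), snd (h (y, 0)))"
    if "y \<in> {1..c}" for y
  proof -
    have y: "y \<in> {1..n}"
      using that c by simp
    show ?thesis
      using insertion_apply[OF m equivariant_perms_range(2)[OF h y m] \<rho>
          equivariant_perms_range(3)[OF h y m], of k] ne[OF that]
      by simp
  qed
  have "strict_mono_on {1..c} (\<lambda>y. fst ((insertion m n k \<rho> \<circ> h) (y, 0)))
      \<longleftrightarrow> strict_mono_on {1..c} (\<lambda>y. ?skip (fst (h (y, 0))))"
    unfolding strict_mono_on_def using * by auto
  also have "\<dots> \<longleftrightarrow> strict_mono_on {1..c} (\<lambda>y. fst (h (y, 0)))"
  proof -
    have "?skip x < ?skip y \<longleftrightarrow> x < y" for x y by auto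
    then show ?thesis
      unfolding strict_mono_on_def by simp
  qed
  finally show ?thesis
    using h comp_equivariant_perms[OF m insertion_in_equivariant_perms[OF m k \<rho>] h] *
    by (simp add: ordered_prefix_def)
qed

text \<open>This is the combinatorial core. Let h be the composition on the left and
  \<open>y0\<close> the point that h sends to position n; z sends it to position k. If b <
  \<open>y0\<close>, the prefix avoids n, and h and z satisfy the condition together. If
  \<open>y0\<close> \<le> b, an ordered prefix of h must place the largest position n last and with
  colour 0, so \<open>y0\<close> = b and \<open>z (b, 0) = (k, \<rho>)\<close>; what remains is the
  condition on the first b - 1 points, which avoid n.\<close>

lemma inv_insertion_comp_in_ordered_prefix_iff:
  assumes m: "0 < m" and k: "k \<in> {1..n}" and \<rho>: "\<rho> \<in> {0..<int m}"
    and z: "z \<in> equivariant_perms m {1..n}" and b: "b \<le> n"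
  shows "inv_into UNIV (insertion m n k \<rho>) \<circ> z \<in> ordered_prefix m n b \<longleftrightarrow>
    k \<in> (\<lambda>y. fst (z (y, 0))) ` {b<..n} \<and> z \<in> ordered_prefix m n b \<or>
    1 \<le> b \<and> z (b, 0) = (k, \<rho>) \<and> z \<in> ordered_prefix m n (b - 1)"
proof -
  let ?g = "insertion m n k \<rho>"
  define h where "h = inv_into UNIV ?g \<circ> z"
  have g: "?g \<in> equivariant_perms m {1..n}"
    by (rule insertion_in_equivariant_perms[OF m k \<rho>])
  have h: "h \<in> equivariant_perms m {1..n}"
    unfolding h_def by (intro comp_equivariant_perms inv_equivariant_perms m g z)
  have zgh: "z = ?g \<circ> h"
    using permutes_inv_o(1)[OF equivariant_permsD(1)[OF g]]
    by (simp add: h_def comp_assoc[symmetric])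
  have n: "1 \<le> n" using k by simp
  have g_apply: "z (y, 0) = (if fst (h (y, 0)) = n then (k, (snd (h (y, 0)) + \<rho>) mod int m)
      else (if fst (h (y, 0)) < k then fst (h (y, 0)) else fst (h (y, 0)) + 1, snd (h (y, 0))))"
    if y: "y \<in> {1..n}" for y
    using insertion_apply[OF m equivariant_perms_range(2)[OF h y m] \<rho>
        equivariant_perms_range(3)[OF h y m], of k]
    by (simp add: zgh)
  have last: "fst (z (y, 0)) = k \<longleftrightarrow> fst (h (y, 0)) = n" if "y \<in> {1..n}" for y
    using g_apply[OF that] by auto
  have last_colour: "z (y, 0) = (k, \<rho>) \<longleftrightarrow> h (y, 0) = (n, 0)" if y: "y \<in> {1..n}" for y
  proof -
    have "(k, \<rho>) = ?g (n, 0)"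
      using insertion_apply[OF m _ \<rho>, of n n 0 k] n m \<rho> by simp
    then show ?thesis
      using permutes_inj[OF equivariant_permsD(1)[OF g]] by (simp add: zgh inj_eq)
  qed
  have inj: "y = y'" if "fst (h (y, 0)) = fst (h (y', 0))" "y \<in> {1..n}" "y' \<in> {1..n}" for y y'
    using inj_onD[OF inj_on_fst_equivariant_perms[OF m h] that(1)] that(2,3) by simp
  have "(\<lambda>y. fst (h (y, 0))) ` {1..n} = {1..n}"
    using equivariant_perms_range(2)[OF h _ m] inj_on_fst_equivariant_perms[OF m h]
    by (intro endo_inj_surj) auto
  then have "n \<in> (\<lambda>y. fst (h (y, 0))) ` {1..n}"
    using n by simp
  then obtain y0 where y0: "y0 \<in> {1..n}" "fst (h (y0, 0)) = n" by auto
  have y0_iff: "fst (h (y, 0)) = n \<longleftrightarrow> y = y0" if "y \<in> {1..n}" for y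
    using inj[of y y0] y0 that by auto
  note prefix_iff = insertion_comp_in_ordered_prefix_iff[OF m k \<rho> h, folded zgh]
  have k_iff: "k \<in> (\<lambda>y. fst (z (y, 0))) ` {b<..n} \<longleftrightarrow> b < y0"
  proof
    assume "k \<in> (\<lambda>y. fst (z (y, 0))) ` {b<..n}"
    then obtain y where "y \<in> {b<..n}" "fst (z (y, 0)) = k" by auto
    moreover from this have "y = y0"
      using last[of y] y0_iff[of y] by simp
    ultimately show "b < y0" by simp
  next
    assume "b < y0"
    then show "k \<in> (\<lambda>y. fst (z (y, 0))) ` {b<..n}"
      using last[OF y0(1)] y0 by (intro image_eqI[of _ _ y0]) simp_all
  qed
  show ?thesis
  proof (cases "b < y0")
    case True
    then have "h \<in> ordered_prefix m n b \<longleftrightarrow> z \<in> ordered_prefix m n b"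
      using y0_iff b by (intro prefix_iff[symmetric]) auto
    moreover have "\<not> (1 \<le> b \<and> z (b, 0) = (k, \<rho>))"
      using last[of b] y0_iff[of b] True b by auto
    ultimately show ?thesis
      using k_iff True by (auto simp flip: h_def)
  next
    case False
    have "h \<in> ordered_prefix m n b \<longleftrightarrow> h (b, 0) = (n, 0) \<and> h \<in> ordered_prefix m n (b - 1)"
    proof
      assume hb: "h \<in> ordered_prefix m n b"
      then have mono: "strict_mono_on {1..b} (\<lambda>y. fst (h (y, 0)))"
        by (simp add: ordered_prefix_def)
      \<comment> \<open>An earlier \<open>y0\<close> would force the image of b beyond the largest
        position n.\<close>
      have "y0 = b"
      proof (rule ccontr)
        assume "y0 \<noteq> b"
        with False y0 have "n < fst (h (b, 0))"
          using strict_mono_onD[OF mono, of y0 b] by simp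
        with equivariant_perms_range(2)[OF h _ m, of b] False y0 b show False
          by simp
      qed
      then have "h (b, 0) = (n, 0)"
        using hb y0 by (auto simp: ordered_prefix_def prod_eq_iff)
      with hb ordered_prefix_antimono[of "b - 1" b]
      show "h (b, 0) = (n, 0) \<and> h \<in> ordered_prefix m n (b - 1)" by auto
    next
      \<comment> \<open>Conversely, the other positions lie below n by injectivity, so adding b at
        the end keeps the prefix ordered.\<close>
      assume hb: "h (b, 0) = (n, 0) \<and> h \<in> ordered_prefix m n (b - 1)"
      have "fst (h (y, 0)) < fst (h (y', 0))" if yy: "y \<in> {1..b}" "y' \<in> {1..b}" "y < y'" for y y'
      proof (cases "y' = b")
        case True
        have "y \<in> {1..n}"
          using yy b by simp
        then have "fst (h (y, 0)) \<noteq> n"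
          using inj[of y b] hb yy b by auto
        with equivariant_perms_range(2)[OF h \<open>y \<in> {1..n}\<close> m] hb True show ?thesis by simp
      next
        case False
        with yy have "y \<in> {1..b - 1}" "y' \<in> {1..b - 1}" by auto
        then show ?thesis
          using hb yy(3) unfolding ordered_prefix_def strict_mono_on_def by blast
      qed
      moreover have "snd (h (y, 0)) = 0" if "y \<in> {1..b}" for y
        using hb that by (cases "y = b") (auto simp: ordered_prefix_def)
      ultimately show "h \<in> ordered_prefix m n b"
        using h by (auto simp: ordered_prefix_def strict_mono_on_def)
    qed
    also have "\<dots> \<longleftrightarrow> z (b, 0) = (k, \<rho>) \<and> z \<in> ordered_prefix m n (b - 1)"
    proof -
      have b1: "b \<in> {1..n}"
        using False y0 b by auto
      have "h \<in> ordered_prefix m n (b - 1) \<longleftrightarrow> z \<in> ordered_prefix m n (b - 1)" if "h (b, 0) = (n, 0)"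
      proof (rule prefix_iff[symmetric])
        show "b - 1 \<le> n" using b by simp
        fix y assume y: "y \<in> {1..b - 1}"
        then have "y \<in> {1..n}" "y \<noteq> b"
          using b1 by auto
        then show "fst (h (y, 0)) \<noteq> n"
          using inj[OF _ _ b1] that by auto
      qed
      with last_colour[OF b1] show ?thesis by blast
    qed
    finally show ?thesis
      using k_iff False y0(1) by (auto simp flip: h_def)
  qed
qed

text \<open>Count the pairs (k, \<rho>) in the two alternatives. The first leaves n - b choices of
  k, the positions of the images of the points after b, and every one of the m colours; the second
  leaves the single pair \<open>z (b, 0)\<close>. For b = 0 the second cannot occur, and the guard
  \<open>1 \<le> b\<close> keeps the truncated b - 1 from counting.\<close>

lemma sum_inv_insertion_in_ordered_prefix:
  assumes m: "0 < m" and z: "z \<in> equivariant_perms m {1..n}" and b: "b \<le> n"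
  shows "(\<Sum>k\<in>{1..n}. \<Sum>\<rho>\<in>{0..<int m}.
      if inv_into UNIV (insertion m n k \<rho>) \<circ> z \<in> ordered_prefix m n b then 1 else 0) =
    of_nat (m * (n - b)) * (if z \<in> ordered_prefix m n b then 1 else 0) +
    (if 1 \<le> b then if z \<in> ordered_prefix m n (b - 1) then 1 else 0 else 0 :: 'a::comm_semiring_1)"
proof -
  let ?f = "\<lambda>y. fst (z (y, 0))"
  let ?K = "?f ` {b<..n}"
  note inj = inj_on_fst_equivariant_perms[OF m z]
  have K: "?K \<subseteq> {1..n}"
    using equivariant_perms_range(2)[OF z _ m] by auto
  have card_K: "card ?K = n - b"
  proof -
    have "{b<..n} \<subseteq> {1..n}" by auto
    from card_image[OF inj_on_subset[OF inj this]] show ?thesis by simp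
  qed
  \<comment> \<open>The alternatives exclude each other, so the indicator of the disjunction is the
    sum of the two indicators.\<close>
  have "?f b \<notin> ?K" if "1 \<le> b"
  proof
    assume "?f b \<in> ?K"
    then obtain y where y: "y \<in> {b<..n}" "?f b = ?f y" by blast
    from inj_onD[OF inj y(2)] y(1) that show False by simp
  qed
  then have "(\<Sum>k\<in>{1..n}. \<Sum>\<rho>\<in>{0..<int m}.
      if inv_into UNIV (insertion m n k \<rho>) \<circ> z \<in> ordered_prefix m n b then 1 else 0 :: 'a) =
    (\<Sum>k\<in>{1..n}. \<Sum>\<rho>\<in>{0..<int m}. (if k \<in> ?K \<and> z \<in> ordered_prefix m n b then 1 else 0) +
      (if 1 \<le> b \<and> z (b, 0) = (k, \<rho>) \<and> z \<in> ordered_prefix m n (b - 1) then 1 else 0))"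
    using inv_insertion_comp_in_ordered_prefix_iff[OF m _ _ z b]
    by (intro sum.cong refl) (auto simp del: atLeastAtMost_iff atLeastLessThan_iff)
  also have "\<dots> = (\<Sum>k\<in>{1..n}. if k \<in> ?K then of_nat m * (if z \<in> ordered_prefix m n b then 1 else 0) else 0) +
      (\<Sum>p\<in>{1..n} \<times> {0..<int m}.
        if p = z (b, 0) then (if 1 \<le> b \<and> z \<in> ordered_prefix m n (b - 1) then 1 else 0) else 0)"
    unfolding sum.distrib
  proof (rule arg_cong2[of _ _ _ _ "(+)"])
    show "(\<Sum>k\<in>{1..n}. \<Sum>\<rho>\<in>{0..<int m}. if k \<in> ?K \<and> z \<in> ordered_prefix m n b then 1 else 0 :: 'a)
      = (\<Sum>k\<in>{1..n}. if k \<in> ?K then of_nat m * (if z \<in> ordered_prefix m n b then 1 else 0) else 0)"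
      by (rule sum.cong) simp_all
    show "(\<Sum>k\<in>{1..n}. \<Sum>\<rho>\<in>{0..<int m}.
        if 1 \<le> b \<and> z (b, 0) = (k, \<rho>) \<and> z \<in> ordered_prefix m n (b - 1) then 1 else 0 :: 'a)
      = (\<Sum>p\<in>{1..n} \<times> {0..<int m}.
          if p = z (b, 0) then (if 1 \<le> b \<and> z \<in> ordered_prefix m n (b - 1) then 1 else 0) else 0)"
      unfolding sum.cartesian_product by (rule sum.cong) auto
  qed
  also have "(\<Sum>k\<in>{1..n}. if k \<in> ?K then of_nat m * (if z \<in> ordered_prefix m n b then 1 else 0) else 0)
      = of_nat (m * (n - b)) * (if z \<in> ordered_prefix m n b then 1 else 0 :: 'a)"
  proof -
    have "(\<Sum>k\<in>{1..n}. if k \<in> ?K then c else 0) = of_nat (card ?K) * c" for c :: 'a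
      by (subst sum.inter_restrict[symmetric]) (simp_all only: Int_absorb1[OF K] sum_constant finite_atLeastAtMost)
    then show ?thesis
      unfolding card_K by (simp only: of_nat_mult mult_ac)
  qed
  also have "(\<Sum>p\<in>{1..n} \<times> {0..<int m}.
        if p = z (b, 0) then (if 1 \<le> b \<and> z \<in> ordered_prefix m n (b - 1) then 1 else 0) else 0)
      = (if 1 \<le> b \<and> z \<in> ordered_prefix m n (b - 1) then 1 else 0 :: 'a)"
    using equivariant_perms_range(1)[OF z _ m, of b] b by auto
  finally show ?thesis
    by (cases "1 \<le> b") (simp_all only: simp_thms if_True if_False)
qed

text \<open>The element R_b of the overview, as a rational coefficient function.\<close>

definition prefix_elt :: "nat \<Rightarrow> nat \<Rightarrow> nat \<Rightarrow> (nat \<times> int \<Rightarrow> nat \<times> int) \<Rightarrow> rat"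
  where "prefix_elt m n b g = (if g \<in> ordered_prefix m n b then 1 else 0)"

context
  fixes m n :: nat and \<gamma> :: int
  assumes m: "0 < m" and n: "1 \<le> n"
    and \<gamma>: "\<gamma> \<in> carrier (cyc m)" "generate (cyc m) {\<gamma>} = carrier (cyc m)"
begin

text \<open>The count of pairs is applied at each x h^(-1) and convolved with v. Carrying v along
  makes this a statement about left multiplication operators, ready for iteration.\<close>

lemma rat_extension_shuffle_op_prefix_elt:
  assumes b: "b \<le> n"
  shows "rat_extension (refl_group m n) (shuffle_op m n \<gamma>) (gr_mult (refl_group m n) (prefix_elt m n b) v) =
    fun_scale (of_nat (m * (n - b))) (gr_mult (refl_group m n) (prefix_elt m n b) v) +
    (if 1 \<le> b then gr_mult (refl_group m n) (prefix_elt m n (b - 1)) v else 0)"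
proof
  fix x
  let ?G = "refl_group m n" and ?s = "\<lambda>k \<rho>. inv_into UNIV (insertion m n k \<rho>)"
  interpret group ?G
    using m by (rule group_refl_group)
  have fin: "finite (carrier ?G)"
    using m by (rule finite_refl_group)
  show "rat_extension ?G (shuffle_op m n \<gamma>) (gr_mult ?G (prefix_elt m n b) v) x =
    (fun_scale (of_nat (m * (n - b))) (gr_mult ?G (prefix_elt m n b) v) +
    (if 1 \<le> b then gr_mult ?G (prefix_elt m n (b - 1)) v else 0)) x"
  proof (cases "x \<in> carrier ?G")
    case True
    have s: "?s k \<rho> \<circ> x \<in> carrier ?G" if "k \<in> {1..n}" "\<rho> \<in> {0..<int m}" for k \<rho>
      using True unfolding carrier_refl_group[OF m]
      by (intro comp_equivariant_perms inv_equivariant_perms insertion_in_equivariant_perms m that)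
    have "rat_extension ?G (shuffle_op m n \<gamma>) (gr_mult ?G (prefix_elt m n b) v) x
      = (\<Sum>k\<in>{1..n}. \<Sum>\<rho>\<in>{0..<int m}. \<Sum>h\<in>carrier ?G.
          prefix_elt m n b (?s k \<rho> \<circ> (x \<circ> inv\<^bsub>?G\<^esub> h)) * v h)"
      unfolding rat_extension_shuffle_op[OF m n \<gamma>] using True s
      by (simp add: gr_mult_eq[OF is_group fin] comp_assoc del: atLeastAtMost_iff atLeastLessThan_iff)
    also have "\<dots> = (\<Sum>h\<in>carrier ?G. (\<Sum>k\<in>{1..n}. \<Sum>\<rho>\<in>{0..<int m}.
          prefix_elt m n b (?s k \<rho> \<circ> (x \<circ> inv\<^bsub>?G\<^esub> h))) * v h)"
      by (simp only: sum.swap[of _ "carrier ?G"] sum_distrib_right)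
    also have "\<dots> = (\<Sum>h\<in>carrier ?G. (of_nat (m * (n - b)) * prefix_elt m n b (x \<circ> inv\<^bsub>?G\<^esub> h) +
        (if 1 \<le> b then prefix_elt m n (b - 1) (x \<circ> inv\<^bsub>?G\<^esub> h) else 0)) * v h)"
    proof (intro sum.cong refl arg_cong2[of _ _ _ _ "(*)"])
      fix h assume "h \<in> carrier ?G"
      then have "x \<circ> inv\<^bsub>?G\<^esub> h \<in> equivariant_perms m {1..n}"
        using m_closed[OF True inv_closed] by (simp add: carrier_refl_group[OF m])
      from sum_inv_insertion_in_ordered_prefix[OF m this b]
      show "(\<Sum>k\<in>{1..n}. \<Sum>\<rho>\<in>{0..<int m}. prefix_elt m n b (?s k \<rho> \<circ> (x \<circ> inv\<^bsub>?G\<^esub> h)))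
        = of_nat (m * (n - b)) * prefix_elt m n b (x \<circ> inv\<^bsub>?G\<^esub> h) +
          (if 1 \<le> b then prefix_elt m n (b - 1) (x \<circ> inv\<^bsub>?G\<^esub> h) else 0)"
        unfolding prefix_elt_def .
    qed
    also have "\<dots> = (fun_scale (of_nat (m * (n - b))) (gr_mult ?G (prefix_elt m n b) v) +
        (if 1 \<le> b then gr_mult ?G (prefix_elt m n (b - 1)) v else 0)) x"
      using True by (simp add: gr_mult_eq[OF is_group fin] fun_scale_def sum_distrib_left
          sum.distrib algebra_simps)
    finally show ?thesis .
  qed (simp add: gr_mult_eq[OF is_group fin] rat_extension_shuffle_op[OF m n \<gamma>] fun_scale_def)
qed

text \<open>For b = n - a the scalar in the recursion is m (n - b) = a m, exactly what the next
  factor subtracts, so only R_(b-1) v survives. At a = n nothing survives, because the recursion for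
  R_0 has no remainder.\<close>

lemma falling_op_shuffle:
  assumes "v \<in> group_ring (refl_group m n)"
  shows "a \<le> n \<Longrightarrow>
    falling_op fun_scale (rat_extension (refl_group m n) (shuffle_op m n \<gamma>)) (\<lambda>k. of_nat (k * m)) a v
      = gr_mult (refl_group m n) (prefix_elt m n (n - a)) v"
    and "falling_op fun_scale (rat_extension (refl_group m n) (shuffle_op m n \<gamma>)) (\<lambda>k. of_nat (k * m)) (Suc n) v = 0"
proof -
  let ?G = "refl_group m n"
  let ?F = "falling_op fun_scale (rat_extension ?G (shuffle_op m n \<gamma>)) (\<lambda>k. of_nat (k * m))"
  interpret group ?G
    using m by (rule group_refl_group)
  have fin: "finite (carrier ?G)"
    using m by (rule finite_refl_group)
  have 0: "gr_mult ?G (prefix_elt m n n) v = v"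
  proof
    fix x
    have "(\<Sum>h\<in>carrier ?G. prefix_elt m n n (x \<otimes>\<^bsub>?G\<^esub> inv\<^bsub>?G\<^esub> h) * v h) = v x" if x: "x \<in> carrier ?G"
    proof -
      have "x \<otimes>\<^bsub>?G\<^esub> inv\<^bsub>?G\<^esub> h = id \<longleftrightarrow> x = h" if "h \<in> carrier ?G" for h
        using inv_solve_right[OF one_closed x that] that by auto
      then have "(\<Sum>h\<in>carrier ?G. prefix_elt m n n (x \<otimes>\<^bsub>?G\<^esub> inv\<^bsub>?G\<^esub> h) * v h)
          = (\<Sum>h\<in>carrier ?G. if x = h then v h else 0)"
        by (intro sum.cong refl) (simp add: prefix_elt_def ordered_prefix_n[OF m])
      then show ?thesis
        using fin x by simp
    qed
    then show "gr_mult ?G (prefix_elt m n n) v x = v x"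
      using assms by (simp add: gr_mult_eq[OF is_group fin] group_ring_def)
  qed
  show *: "?F a v = gr_mult ?G (prefix_elt m n (n - a)) v" if "a \<le> n" for a
    using that
  proof (induction a)
    case (Suc a)
    then have IH: "?F a v = gr_mult ?G (prefix_elt m n (n - a)) v"
      and eq: "m * (n - (n - a)) = a * m" "1 \<le> n - a" "n - a - 1 = n - Suc a"
      by auto
    let ?w = "\<lambda>b. gr_mult ?G (prefix_elt m n b) v"
    have "rat_extension ?G (shuffle_op m n \<gamma>) (?w (n - a))
        = fun_scale (of_nat (a * m)) (?w (n - a)) + ?w (n - Suc a)"
      using rat_extension_shuffle_op_prefix_elt[of "n - a" v] eq(2) unfolding eq(1,3) by simp
    then show ?case
      by (simp only: falling_op.simps IH add_diff_cancel_left')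
  qed (simp add: 0)
  show "?F (Suc n) v = 0"
    using rat_extension_shuffle_op_prefix_elt[of 0 v] *[OF order_refl]
    by (simp add: mult.commute)
qed

end

section \<open>Counting fixed points\<close>

text \<open>An equivariant map that fixes a base point fixes all its colours. Since permutations are
  the identity off their domain, the pointwise stabilizer of A is literally, not just up to
  isomorphism, the group over X - A.\<close>

lemma equivariant_perms_Diff:
  assumes "0 < m" and "A \<subseteq> X"
  shows "equivariant_perms m (X - A) = {g \<in> equivariant_perms m X. \<forall>x\<in>A. g (x, 0) = (x, 0)}"
proof (intro equalityI subsetI)
  fix g assume g: "g \<in> equivariant_perms m (X - A)"
  note P = equivariant_permsD(1)[OF g]
  have fix_A: "g (x, \<rho>) = (x, \<rho>)" if "x \<in> A" for x \<rho>
    using permutes_not_in[OF P] that by simp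
  have "g permutes X \<times> {0..<int m}"
    using P by (rule permutes_subset) auto
  moreover have "g (x, \<rho>) = act m \<rho> (g (x, 0))" if "x \<in> X" "\<rho> \<in> {0..<int m}" for x \<rho>
    using equivariant_permsD(2)[OF g, of x \<rho>] that fix_A[of x] by (cases "x \<in> A") simp_all
  ultimately show "g \<in> {g \<in> equivariant_perms m X. \<forall>x\<in>A. g (x, 0) = (x, 0)}"
    using fix_A unfolding equivariant_perms_def by blast
next
  fix g assume g: "g \<in> {g \<in> equivariant_perms m X. \<forall>x\<in>A. g (x, 0) = (x, 0)}"
  then have gX: "g \<in> equivariant_perms m X" by simp
  have "g permutes (X - A) \<times> {0..<int m}"
  proof (rule permutes_superset[OF equivariant_permsD(1)[OF gX]])
    fix p assume "p \<in> X \<times> {0..<int m} - (X - A) \<times> {0..<int m}"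
    then obtain x \<rho> where "p = (x, \<rho>)" "x \<in> A" "\<rho> \<in> {0..<int m}" by blast
    then show "g p = p"
      using equivariant_permsD(2)[OF gX, of x \<rho>] g assms(2) by auto
  qed
  then show "g \<in> equivariant_perms m (X - A)"
    using equivariant_permsD(2)[OF gX] unfolding equivariant_perms_def by blast
qed

text \<open>Y - X and X - Y have equal size, so a bijection from X to Y can be completed by one from
  Y - X to X - Y and by the identity elsewhere. A bijection of the whole type makes conjugation by
  it total.\<close>

lemma bij_extension:
  fixes X Y :: "'a set"
  assumes "finite X" and "finite Y" and "card X = card Y"
  obtains \<phi> :: "'a \<Rightarrow> 'a" where "bij \<phi>" "\<phi> ` X = Y"
proof -
  obtain f where f: "bij_betw f X Y"
    using finite_same_card_bij assms by blast
  have "card (Y - X) = card (X - Y)"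
    using assms card_Diff_subset_Int[of Y X] card_Diff_subset_Int[of X Y]
    by (simp add: Int_commute)
  then obtain g where g: "bij_betw g (Y - X) (X - Y)"
    using finite_same_card_bij assms by (metis finite_Diff)
  define \<phi> where "\<phi> x = (if x \<in> X then f x else if x \<in> Y then g x else x)" for x
  have 1: "bij_betw \<phi> X Y"
    using f by (simp add: \<phi>_def cong: bij_betw_cong)
  have "bij_betw \<phi> (Y - X) (X - Y)"
    using g bij_betw_cong[of "Y - X" \<phi> g] by (simp add: \<phi>_def)
  with 1 have "bij_betw \<phi> (X \<union> (Y - X)) (Y \<union> (X - Y))"
    by (rule bij_betw_combine) auto
  then have "bij_betw \<phi> (X \<union> Y) (X \<union> Y)"
    by (simp add: Un_commute)
  then have "\<phi> permutes X \<union> Y"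
    by (rule bij_imp_permutes) (simp add: \<phi>_def)
  then show thesis
    using that[of \<phi>] 1 permutes_bij by (auto simp: bij_betw_def)
qed

text \<open>Conjugation by a relabelling of positions is injective and carries fixed points to fixed
  points. An inequality is enough, as X and Y may be exchanged. The predicate Q lets one statement
  serve for the group order and for the derangements.\<close>

lemma card_equivariant_perms_relabel_le:
  assumes "0 < m" and fin: "finite X" "finite Y" and "card X = card Y"
  shows "card {g \<in> equivariant_perms m X. Q (card {x \<in> X. g (x, 0) = (x, 0)})}
    \<le> card {g \<in> equivariant_perms m Y. Q (card {x \<in> Y. g (x, 0) = (x, 0)})}"
proof -
  obtain \<phi> where \<phi>: "bij \<phi>" "\<phi> ` X = Y"
    using bij_extension[OF fin assms(4)] by blast
  define \<Phi> :: "nat \<times> int \<Rightarrow> nat \<times> int" where "\<Phi> = map_prod \<phi> id"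
  define \<Psi> :: "nat \<times> int \<Rightarrow> nat \<times> int" where "\<Psi> = map_prod (inv_into UNIV \<phi>) id"
  have \<phi>_inv: "\<phi> (inv_into UNIV \<phi> y) = y" "inv_into UNIV \<phi> (\<phi> x) = x" for x y
    using \<phi>(1) by (simp_all add: bij_is_surj bij_is_inj surj_f_inv_f)
  have \<Phi>\<Psi>: "\<Phi> (\<Psi> p) = p" "\<Psi> (\<Phi> p) = p" for p
    by (cases p; simp add: \<Phi>_def \<Psi>_def \<phi>_inv)+
  have \<phi>_mem: "\<phi> x \<in> Y \<longleftrightarrow> x \<in> X" for x
    using \<phi> by (metis bij_is_inj inj_image_mem_iff)
  let ?c = "\<lambda>g. \<Phi> \<circ> g \<circ> \<Psi>"
  have c_mem: "?c g \<in> equivariant_perms m Y" if g: "g \<in> equivariant_perms m X" for g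
    unfolding equivariant_perms_def
  proof (intro CollectI conjI ballI)
    note P = equivariant_permsD(1)[OF g]
    have bij_c: "bij (?c g)"
      using permutes_bij[OF P] \<Phi>\<Psi> by (intro bij_comp) (auto intro!: o_bij simp: fun_eq_iff)
    have "?c g p = p" if "p \<notin> Y \<times> {0..<int m}" for p
    proof -
      have "\<Psi> p \<notin> X \<times> {0..<int m}"
        using that \<phi>_mem[of "inv_into UNIV \<phi> (fst p)"] by (cases p) (auto simp: \<Psi>_def \<phi>_inv)
      then show ?thesis
        using permutes_not_in[OF P] \<Phi>\<Psi> by simp
    qed
    with bij_c show "?c g permutes Y \<times> {0..<int m}"
      unfolding permutes_def bij_iff by blast
    fix y \<rho> assume y: "y \<in> Y" and r: "\<rho> \<in> {0..<int m}"
    then have "inv_into UNIV \<phi> y \<in> X"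
      using \<phi>_mem[of "inv_into UNIV \<phi> y"] by (simp add: \<phi>_inv)
    from equivariant_permsD(2)[OF g this r]
    show "?c g (y, \<rho>) = act m \<rho> (?c g (y, 0))"
      by (simp add: \<Psi>_def \<Phi>_def act_def)
  qed
  have c_fix: "card {x \<in> Y. ?c g (x, 0) = (x, 0)} = card {x \<in> X. g (x, 0) = (x, 0)}" for g
  proof -
    have eq: "?c g (\<phi> x, 0) = (\<phi> x, 0) \<longleftrightarrow> g (x, 0) = (x, 0)" for x
    proof -
      have "(\<phi> x, 0) = \<Phi> (x, 0)" "\<Psi> (\<phi> x, 0) = (x, 0)"
        by (simp_all add: \<Phi>_def \<Psi>_def \<phi>_inv)
      then show ?thesis
        using \<Phi>\<Psi>(2) by (metis comp_apply)
    qed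
    have "{x \<in> Y. ?c g (x, 0) = (x, 0)} = \<phi> ` {x \<in> X. g (x, 0) = (x, 0)}"
      using eq \<phi>(2) by blast
    then show ?thesis
      using card_image[OF inj_on_subset[OF bij_is_inj[OF \<phi>(1)] subset_UNIV]] by simp
  qed
  show ?thesis
  proof (rule card_inj_on_le)
    show "inj_on ?c {g \<in> equivariant_perms m X. Q (card {x \<in> X. g (x, 0) = (x, 0)})}"
    proof (rule inj_onI)
      fix g h assume "?c g = ?c h"
      then have "\<Psi> (?c g (\<Phi> p)) = \<Psi> (?c h (\<Phi> p))" for p by simp
      then show "g = h"
        by (simp add: \<Phi>\<Psi> fun_eq_iff)
    qed
  qed (use c_mem c_fix fin in \<open>auto simp: finite_equivariant_perms\<close>)
qed

lemma card_equivariant_perms_relabel: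
  assumes "0 < m" and "finite X" "finite Y" and "card X = card Y"
  shows "card {g \<in> equivariant_perms m X. Q (card {x \<in> X. g (x, 0) = (x, 0)})}
    = card {g \<in> equivariant_perms m Y. Q (card {x \<in> Y. g (x, 0) = (x, 0)})}"
  using assms by (intro antisym card_equivariant_perms_relabel_le) auto

text \<open>Orbit and stabilizer of the last base point: each element factors uniquely as the
  insertion with the same image of that point, followed on the right by an element fixing it. There
  are (n + 1) m insertions, and the stabilizer is the group over {1..n}.\<close>

lemma card_equivariant_perms:
  assumes m: "0 < m"
  shows "card (equivariant_perms m {1..n}) = m ^ n * fact n"
proof (induction n)
  case 0
  have "equivariant_perms m {1..0} = {id}"
    by (auto simp: equivariant_perms_def)
  then show ?case by simp
next
  case (Suc n)
  let ?E = "equivariant_perms m" and ?s = "insertion m (Suc n)" and ?N = "{1..Suc n}"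
  have sub: "?E {1..n} = {g \<in> ?E ?N. g (Suc n, 0) = (Suc n, 0)}"
    using equivariant_perms_Diff[OF m, of "{Suc n}" ?N] by (simp add: atLeastAtMostSuc_conv)
  have s: "?s k \<rho> \<in> ?E ?N" if "k \<in> ?N" "\<rho> \<in> {0..<int m}" for k \<rho>
    by (rule insertion_in_equivariant_perms[OF m that])
  have s_last: "?s k \<rho> (Suc n, 0) = (k, \<rho>)" if "\<rho> \<in> {0..<int m}" for k \<rho>
    using insertion_apply[OF m _ that, of "Suc n" "Suc n" 0 k] m that by simp
  have "bij_betw (\<lambda>((k, \<rho>), h). ?s k \<rho> \<circ> h) ((?N \<times> {0..<int m}) \<times> ?E {1..n}) (?E ?N)"
    unfolding bij_betw_def
  proof
    show "inj_on (\<lambda>((k, \<rho>), h). ?s k \<rho> \<circ> h) ((?N \<times> {0..<int m}) \<times> ?E {1..n})"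
    proof (rule inj_onI, clarsimp simp del: atLeastAtMost_iff atLeastLessThan_iff)
      fix k \<rho> h k' \<rho>' h'
      assume k: "k \<in> {Suc 0..Suc n}" "\<rho> \<in> {0..<int m}" and k': "k' \<in> {Suc 0..Suc n}" "\<rho>' \<in> {0..<int m}"
        and h: "h \<in> ?E {Suc 0..n}" "h' \<in> ?E {Suc 0..n}" and eq: "?s k \<rho> \<circ> h = ?s k' \<rho>' \<circ> h'"
      from fun_cong[OF eq, of "(Suc n, 0)"] have kk: "k = k' \<and> \<rho> = \<rho>'"
        using h sub s_last k k' by simp
      have "inj (?s k \<rho>)"
        using permutes_inj[OF equivariant_permsD(1)[OF s]] k by simp
      then show "k = k' \<and> \<rho> = \<rho>' \<and> h = h'"
        using eq kk by (simp add: fun_eq_iff inj_eq)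
    qed
    have into: "?s k \<rho> \<circ> h \<in> ?E ?N" if "k \<in> ?N" "\<rho> \<in> {0..<int m}" "h \<in> ?E {1..n}" for k \<rho> h
      using that(3) sub by (intro comp_equivariant_perms m s that) auto
    have onto: "z \<in> (\<lambda>((k, \<rho>), h). ?s k \<rho> \<circ> h) ` ((?N \<times> {0..<int m}) \<times> ?E {1..n})"
      if z: "z \<in> ?E ?N" for z
    proof -
      obtain k \<rho> where kr: "z (Suc n, 0) = (k, \<rho>)" by fastforce
      then have k: "k \<in> ?N" "\<rho> \<in> {0..<int m}"
        using equivariant_perms_range(1)[OF z _ m, of "Suc n"] by auto
      note P = equivariant_permsD(1)[OF s[OF k]]
      let ?h = "inv_into UNIV (?s k \<rho>) \<circ> z"
      have "?h \<in> ?E ?N"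
        by (intro comp_equivariant_perms inv_equivariant_perms m s k z)
      moreover have "?h (Suc n, 0) = (Suc n, 0)"
        using s_last[OF k(2), of k] permutes_inverses(2)[OF P] kr by (metis comp_apply)
      moreover have "z = ?s k \<rho> \<circ> ?h"
        by (simp add: fun_eq_iff permutes_inverses(1)[OF P])
      ultimately show ?thesis
        using k unfolding sub by (intro image_eqI[of _ _ "((k, \<rho>), ?h)"]) simp_all
    qed
    show "(\<lambda>((k, \<rho>), h). ?s k \<rho> \<circ> h) ` ((?N \<times> {0..<int m}) \<times> ?E {1..n}) = ?E ?N"
    proof (intro equalityI subsetI onto)
      fix z assume "z \<in> (\<lambda>((k, \<rho>), h). ?s k \<rho> \<circ> h) ` ((?N \<times> {0..<int m}) \<times> ?E {1..n})"
      then obtain k \<rho> h where "z = ?s k \<rho> \<circ> h" "k \<in> ?N" "\<rho> \<in> {0..<int m}" "h \<in> ?E {1..n}"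
        by fastforce
      then show "z \<in> ?E ?N"
        using into by blast
    qed
  qed
  from bij_betw_same_card[OF this] have "card (?E ?N) = Suc n * m * (m ^ n * fact n)"
    unfolding card_cartesian_product Suc by simp
  then show ?case
    by (simp add: algebra_simps)
qed

lemma card_equivariant_perms_card:
  assumes "0 < m" and "finite X"
  shows "card (equivariant_perms m X) = m ^ card X * fact (card X)"
  using card_equivariant_perms_relabel[OF assms(1,2), of "{1..card X}" "\<lambda>_. True"]
    card_equivariant_perms[OF assms(1)] by simp

lemma derangement_number_eq:
  assumes "0 < m" and "finite X"
  shows "card {g \<in> equivariant_perms m X. {x \<in> X. g (x, 0) = (x, 0)} = {}} = derangement_number m (card X)"
  using card_equivariant_perms_relabel[OF assms(1,2), of "{1..card X}" "\<lambda>c. c = 0"] assms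
  by (simp add: derangement_number_def carrier_refl_group fixed_points_def)

text \<open>Sort by the set A of fixed points: an element with fixed set exactly A is a derangement
  of the n - i remaining positions.\<close>

lemma card_fixed_points_eq:
  assumes m: "0 < m"
  shows "card {g \<in> carrier (refl_group m n). card (fixed_points m n g) = i}
    = (n choose i) * derangement_number m (n - i)"
proof -
  let ?G = "carrier (refl_group m n)" and ?S = "{A. A \<subseteq> {1..n} \<and> card A = i}"
  have fin: "finite ?S" by simp
  have "{g \<in> ?G. card (fixed_points m n g) = i} = (\<Union>A\<in>?S. {g \<in> ?G. fixed_points m n g = A})"
    by (auto simp: fixed_points_def)
  also have "card \<dots> = (\<Sum>A\<in>?S. card {g \<in> ?G. fixed_points m n g = A})"
    using fin finite_refl_group[OF m] by (intro card_UN_disjoint) auto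
  also have "\<dots> = (\<Sum>A\<in>?S. derangement_number m (n - i))"
  proof (intro sum.cong refl)
    fix A assume A: "A \<in> ?S"
    then have "{g \<in> ?G. fixed_points m n g = A} =
      {g \<in> equivariant_perms m ({1..n} - A). {x \<in> {1..n} - A. g (x, 0) = (x, 0)} = {}}"
      using equivariant_perms_Diff[OF m, of A "{1..n}"]
      by (auto simp: carrier_refl_group[OF m] fixed_points_def)
    moreover have "card ({1..n} - A) = n - i"
      using A finite_subset[of A "{1..n}"] by (simp add: card_Diff_subset)
    ultimately show "card {g \<in> ?G. fixed_points m n g = A} = derangement_number m (n - i)"
      using derangement_number_eq[OF m, of "{1..n} - A"] by simp
  qed
  also have "\<dots> = (n choose i) * derangement_number m (n - i)"
    by (simp add: n_subsets)
  finally show ?thesis .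
qed

text \<open>Double counting of the pairs of an element g and an a-set A of its fixed points: for
  given A, the elements g are the group over the n - a other positions.\<close>

lemma sum_fixed_points_choose:
  assumes m: "0 < m"
  shows "(\<Sum>g\<in>carrier (refl_group m n). card (fixed_points m n g) choose a)
    = (n choose a) * (m ^ (n - a) * fact (n - a))"
proof -
  let ?G = "carrier (refl_group m n)" and ?S = "{A. A \<subseteq> {1..n} \<and> card A = a}"
  have "card (fixed_points m n g) choose a = (\<Sum>A\<in>?S. if A \<subseteq> fixed_points m n g then 1 else 0)" for g
  proof -
    have "finite (fixed_points m n g)"
      by (simp add: fixed_points_def)
    then have "card (fixed_points m n g) choose a = card {A. A \<subseteq> fixed_points m n g \<and> card A = a}"
      by (simp add: n_subsets)
    also have "{A. A \<subseteq> fixed_points m n g \<and> card A = a} = {A \<in> ?S. A \<subseteq> fixed_points m n g}"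
      by (auto simp: fixed_points_def)
    also have "card \<dots> = (\<Sum>A\<in>?S. if A \<subseteq> fixed_points m n g then 1 else 0)"
      by (simp add: sum.If_cases Int_def)
    finally show ?thesis .
  qed
  then have "(\<Sum>g\<in>?G. card (fixed_points m n g) choose a)
      = (\<Sum>A\<in>?S. \<Sum>g\<in>?G. if A \<subseteq> fixed_points m n g then 1 else 0)"
    by (simp only: sum.swap[of _ ?S])
  also have "\<dots> = (\<Sum>A\<in>?S. m ^ (n - a) * fact (n - a))"
  proof (intro sum.cong refl)
    fix A assume A: "A \<in> ?S"
    have "(\<Sum>g\<in>?G. if A \<subseteq> fixed_points m n g then 1 else 0) = card {g \<in> ?G. A \<subseteq> fixed_points m n g}"
      using finite_refl_group[OF m] by (simp add: sum.If_cases Int_def)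
    also have "{g \<in> ?G. A \<subseteq> fixed_points m n g} = equivariant_perms m ({1..n} - A)"
      using A equivariant_perms_Diff[OF m, of A "{1..n}"]
      by (auto simp: carrier_refl_group[OF m] fixed_points_def)
    also have "card \<dots> = m ^ (n - a) * fact (n - a)"
      using card_equivariant_perms_card[OF m, of "{1..n} - A"] A finite_subset[of A "{1..n}"]
      by (simp add: card_Diff_subset)
    finally show "(\<Sum>g\<in>?G. if A \<subseteq> fixed_points m n g then 1 else 0) = m ^ (n - a) * fact (n - a)" .
  qed
  also have "\<dots> = (n choose a) * (m ^ (n - a) * fact (n - a))"
    by (simp add: n_subsets)
  finally show ?thesis .
qed

section \<open>Traces and multiplicities\<close>

lemma sum_choose_group:
  assumes "finite S" and "f ` S \<subseteq> {..n}"
  shows "(\<Sum>x\<in>S. f x choose a) = (\<Sum>i\<le>n. card {x \<in> S. f x = i} * (i choose a))"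
  using sum.group[OF assms(1) finite_atMost assms(2), of "\<lambda>x. f x choose a"] by simp

text \<open>The scalar by which the falling product acts on an eigenvector for i m: m^a times the
  falling factorial i (i-1) ... (i-a+1), which is 0 when i < a.\<close>

lemma prod_diff_multiples:
  "(\<Prod>k<a. of_nat (i * m) - of_nat (k * m)) = (of_nat (m ^ a * (fact a * (i choose a))) :: rat)"
proof -
  have "(\<Prod>k<a. of_nat (i * m) - of_nat (k * m)) = (\<Prod>k<a. of_nat m * (of_nat i - of_nat k :: rat))"
    by (simp add: algebra_simps)
  also have "\<dots> = of_nat m ^ a * (\<Prod>k = 0..<a. of_nat i - of_nat k)"
    by (simp add: prod.distrib lessThan_atLeast0)
  also have "\<dots> = of_nat (m ^ a * (fact a * (i choose a)))"
    by (simp add: gbinomial_mult_fact[symmetric] binomial_gbinomial)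
  finally show ?thesis .
qed

text \<open>Each diagonal entry is the coefficient of g g^(-1) = 1 in R_b. It equals 1, because the
  identity has every prefix ordered and uncoloured.\<close>

lemma trace_prefix_elt:
  assumes "0 < m" and "b \<le> n"
  shows "(\<Sum>g\<in>carrier (refl_group m n). gr_mult (refl_group m n) (prefix_elt m n b) (gr_of g) g)
    = of_nat (m ^ n * fact n)"
proof -
  let ?G = "refl_group m n"
  interpret group ?G
    using assms(1) by (rule group_refl_group)
  have fin: "finite (carrier ?G)"
    using assms(1) by (rule finite_refl_group)
  have "id \<in> ordered_prefix m n b"
    using ordered_prefix_antimono[OF assms(2), of m n] ordered_prefix_n[OF assms(1)] by simp
  moreover have "gr_mult ?G (prefix_elt m n b) (gr_of g) g = prefix_elt m n b (g \<otimes>\<^bsub>?G\<^esub> inv\<^bsub>?G\<^esub> g)"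
    if "g \<in> carrier ?G" for g
  proof -
    have "gr_mult ?G (prefix_elt m n b) (gr_of g) g
      = (\<Sum>h\<in>carrier ?G. if h = g then prefix_elt m n b (g \<otimes>\<^bsub>?G\<^esub> inv\<^bsub>?G\<^esub> h) else 0)"
      unfolding gr_mult_eq[OF is_group fin] using that by (simp add: gr_of_def) (intro sum.cong; simp)
    then show ?thesis
      using that fin by (simp add: sum.delta)
  qed
  ultimately have "(\<Sum>g\<in>carrier ?G. gr_mult ?G (prefix_elt m n b) (gr_of g) g) = of_nat (card (carrier ?G))"
    by (simp add: r_inv prefix_elt_def del: mult_refl_group)
  then show ?thesis
    using card_equivariant_perms[OF assms(1), of n] by (simp add: carrier_refl_group[OF assms(1)])
qed

theorem theorem3:
  fixes m n :: nat and \<gamma> :: int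
  assumes "m \<ge> 1" and "n \<ge> 1"
    and "\<gamma> \<in> carrier (cyc m)" and "generate (cyc m) {\<gamma>} = carrier (cyc m)"
  defines "V \<equiv> (group_ring (refl_group m n) :: ((nat \<times> int \<Rightarrow> nat \<times> int) \<Rightarrow> rat) set)"
    and "L \<equiv> rat_extension (refl_group m n) (shuffle_op m n \<gamma>)"
  shows "fun_space.diagonalizable_on V L \<and>
    {c. fun_space.eigenvalue_on V L c} =
      {of_nat (i * m) |i. i \<le> n \<and> (n choose i) * derangement_number m (n - i) \<noteq> 0} \<and>
    (\<forall>i\<le>n.
      fun_space.multiplicity_on V L (of_nat (i * m)) =
        (n choose i) * derangement_number m (n - i) \<and>
      (n choose i) * derangement_number m (n - i) =
        card {g \<in> carrier (refl_group m n). card (fixed_points m n g) = i})"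
proof -
  let ?G = "refl_group m n" and ?c = "\<lambda>k. rat_of_nat (k * m)"
  have m: "0 < m"
    using assms(1) by simp
  have fin: "finite (carrier ?G)"
    using m by (rule finite_refl_group)
  have hom: "module_hom fun_scale fun_scale L"
    unfolding L_def by (rule module_hom_rat_extension)
  have V: "fun_space.subspace V"
    unfolding V_def by (rule subspace_group_ring)
  have LV: "L ` V \<subseteq> V"
    by (auto simp: V_def L_def group_ring_def rat_extension_shuffle_op[OF m assms(2-4)])
  have inj: "inj_on ?c {..<Suc n}"
    using m by (auto simp: inj_on_def)
  have "falling_op fun_scale L ?c (Suc n) v = 0" if "v \<in> V" for v
    using falling_op_shuffle(2)[OF m assms(2-4)] that unfolding L_def V_def .
  from fun_space.eigenbasis_exists[OF hom V LV inj this]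
  obtain B where B: "fun_space.independent B" "fun_space.span B = V"
    and "\<forall>b\<in>B. \<exists>k<Suc n. L b = fun_scale (?c k) b" by blast
  then obtain idx where idx: "\<And>b. b \<in> B \<Longrightarrow> idx b < Suc n \<and> L b = fun_scale (?c (idx b)) b"
    by metis
  have fin_B: "finite B"
    using finite_independent_group_ring[OF fin B(1)] B(2) fun_space.span_superset V_def by blast
  have c_eq: "?c i = ?c j \<longleftrightarrow> i = j" for i j
    using m by simp
  have mult: "fun_space.multiplicity_on V L (?c i) = card {b \<in> B. idx b = i}" for i
    using fun_space.multiplicity_on_eigenbasis[OF hom B(1) fin_B, of "\<lambda>b. ?c (idx b)" "?c i"] idx
    unfolding B(2) c_eq by blast
  have eigen: "fun_space.eigenvalue_on V L r \<longleftrightarrow> r \<in> (\<lambda>b. ?c (idx b)) ` B" for r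
    using fun_space.eigenvalue_on_eigenbasis[OF hom B(1) fin_B, of "\<lambda>b. ?c (idx b)" r] idx
    unfolding B(2) by blast
  \<comment> \<open>The trace of the falling product is computed twice: in the eigenbasis through
    its scalars, and in the basis of group elements through R_(n-a).\<close>
  have moments: "(\<Sum>b\<in>B. idx b choose a) = (\<Sum>g\<in>carrier ?G. card (fixed_points m n g) choose a)"
    if a: "a \<le> n" for a
  proof -
    let ?F = "falling_op fun_scale L ?c a"
    have F_hom: "module_hom fun_scale fun_scale ?F"
      by (rule fun_space.module_hom_falling_op[OF hom])
    have F_eigen: "?F b = fun_scale (\<Prod>k<a. ?c (idx b) - ?c k) b" if "b \<in> B" for b
      by (rule fun_space.falling_op_eigenvector[where e = "?c (idx b)", OF hom])
        (rule conjunct2[OF idx[OF that]])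
    have "rat_of_nat (\<Sum>b\<in>B. m ^ a * (fact a * (idx b choose a))) = (\<Sum>b\<in>B. \<Prod>k<a. ?c (idx b) - ?c k)"
      by (subst of_nat_sum) (rule sum.cong[OF refl prod_diff_multiples[symmetric]])
    also have "\<dots> = (\<Sum>g\<in>carrier ?G. ?F (gr_of g) g)"
      using trace_eigenbasis[where T = ?F and e = "\<lambda>b. \<Prod>k<a. ?c (idx b) - ?c k",
          OF F_hom fin B(1) B(2)[unfolded V_def] F_eigen] by (rule sym)
    also have "\<dots> = (\<Sum>g\<in>carrier ?G. gr_mult ?G (prefix_elt m n (n - a)) (gr_of g) g)"
      unfolding L_def
      by (rule sum.cong[OF refl]) (rule fun_cong[OF
            falling_op_shuffle(1)[OF m assms(2-4) gr_of_in_group_ring a]])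
    also have "\<dots> = of_nat (m ^ n * fact n)"
      by (rule trace_prefix_elt[OF m diff_le_self])
    finally have "m ^ a * fact a * (\<Sum>b\<in>B. idx b choose a) = m ^ n * fact n"
      by (simp only: of_nat_eq_iff sum_distrib_left mult.assoc)
    \<comment> \<open>Splitting m^n and n! exposes the factor m^a a!, which is then cancelled; this
      needs m > 0.\<close>
    also have "\<dots> = (m ^ a * m ^ (n - a)) * (fact a * fact (n - a) * (n choose a))"
      by (simp only: binomial_fact_lemma[OF a] power_add[symmetric] le_add_diff_inverse[OF a])
    also have "\<dots> = m ^ a * fact a * ((n choose a) * (m ^ (n - a) * fact (n - a)))"
      by (simp only: mult_ac)
    finally have "(\<Sum>b\<in>B. idx b choose a) = (n choose a) * (m ^ (n - a) * fact (n - a))"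
      using m by simp
    then show ?thesis
      by (simp add: sum_fixed_points_choose[OF m])
  qed
  have fix_le: "(\<lambda>g. card (fixed_points m n g)) ` carrier ?G \<subseteq> {..n}"
  proof (rule image_subsetI)
    fix g
    have "fixed_points m n g \<subseteq> {1..n}"
      by (auto simp: fixed_points_def)
    then show "card (fixed_points m n g) \<in> {..n}"
      using card_mono[of "{1..n}"] by fastforce
  qed
  have idx_le: "idx ` B \<subseteq> {..n}"
  proof (rule image_subsetI)
    fix b assume "b \<in> B"
    from idx[OF this] show "idx b \<in> {..n}" by simp
  qed
  have card_eq: "card {b \<in> B. idx b = i} = (n choose i) * derangement_number m (n - i)" if "i \<le> n" for i
  proof -
    have "card {b \<in> B. idx b = i} = card {g \<in> carrier ?G. card (fixed_points m n g) = i}"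
      by (rule eq_if_binomial_moments_eq[OF _ that])
        (use moments in \<open>simp only: sum_choose_group[OF fin_B idx_le] sum_choose_group[OF fin fix_le]\<close>)
    then show ?thesis
      by (simp add: card_fixed_points_eq[OF m])
  qed
  have "fun_space.diagonalizable_on V L"
    unfolding fun_space.diagonalizable_on_def using B idx by blast
  moreover have "{c. fun_space.eigenvalue_on V L c} =
      {of_nat (i * m) |i. i \<le> n \<and> (n choose i) * derangement_number m (n - i) \<noteq> 0}"
  proof -
    \<comment> \<open>A nonzero multiplicity means that some basis vector has index i, so the values
      i m with multiplicity 0 drop out of the spectrum.\<close>
    have nz: "(n choose i) * derangement_number m (n - i) \<noteq> 0 \<longleftrightarrow> (\<exists>b\<in>B. idx b = i)" if "i \<le> n" for i
      unfolding card_eq[OF that, symmetric] using fin_B by auto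
    have "r \<in> (\<lambda>b. ?c (idx b)) ` B \<longleftrightarrow>
        (\<exists>i. r = ?c i \<and> i \<le> n \<and> (n choose i) * derangement_number m (n - i) \<noteq> 0)" for r
    proof
      assume "r \<in> (\<lambda>b. ?c (idx b)) ` B"
      then obtain b where "b \<in> B" "r = ?c (idx b)" by blast
      moreover from this idx_le have "idx b \<le> n" by auto
      ultimately show "\<exists>i. r = ?c i \<and> i \<le> n \<and> (n choose i) * derangement_number m (n - i) \<noteq> 0"
        using nz by blast
    qed (use nz in blast)
    then show ?thesis
      unfolding eigen by (rule Collect_cong)
  qed
  ultimately show ?thesis
    by (intro conjI allI impI) (simp_all only: mult card_eq card_fixed_points_eq[OF m])
qed

end
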